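(* Let $\kappa$ be a regular uncountable cardinal and $\ell\in\{1,2,3\}$. Let $\langle\mu_i:i<\kappa\rangle$ be a strictly increasing continuous sequence of cardinals with limit $\mu$, and put $\lambda_i=\mu_i^+$, $\lambda=\mu^+$. Assume $2^\kappa<\mu$ and $\mu_i^\kappa<\mu$ for all $i<\kappa$. Let $D$ be a normal filter on $\kappa$, let $\theta_i<\mathfrak{dp}^{\ell+}_{\lambda_i}$ for $i<\kappa$, and let $\theta<\mathrm{Depth}^+(\prod_{i<\kappa}\theta_i,<_D)$ (e.g. $\theta=\mathrm{tcf}(\prod_{i<\kappa}\theta_i/D)$). Then $\theta<\mathfrak{dp}^{\ell+}_\lambda$.
   Context: For regular $\lambda>\aleph_0$ and $J^{bd}_\lambda$ the ideal of bounded subsets ($f<_{J^{bd}_\lambda}g$ iff $\{i:f(i)\ge g(i)\}$ bounded): $\mathfrak{dp}^{1+}_\lambda$ is the least $\theta$ such that there is no sequence $\langle C_\alpha:\alpha<\theta\rangle$ of clubs of $\lambda$ with $|C_\alpha\setminus C_\beta|<\lambda$ for $\alpha<\beta$ and $C_{\alpha+1}\subseteq\mathrm{acc}(C_\alpha)$ (accumulation points); $\mathfrak{dp}^{2+}_\lambda$ is the least $\mu$ with no $<_{J^{bd}_\lambda}$-increasing sequence $\langle f_\alpha:\alpha<\mu\rangle$ in ${}^\lambda\lambda$; $\mathfrak{dp}^{3+}_\lambda$ is the least $\mu$ with no sequence $\langle A_\alpha:\alpha<\mu\rangle$ of unbounded subsets of $\lambda$ such that for $\alpha<\beta$, $A_\beta\setminus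 A_\alpha$ is unbounded and $A_\alpha\setminus A_\beta$ bounded. $f<_D g$ means $\{i:f(i)<g(i)\}\in D$. $\mathrm{Depth}^+(\prod\theta_i,<_D)$ is the least $\chi$ such that there is no sequence $\langle g_\alpha:\alpha<\chi\rangle$ in $\prod\theta_i$ with $\alpha<\beta\Rightarrow g_\alpha<_D g_\beta$. *)

theory Defs
  imports Complex_Main "HOL-Library.FuncSet"
begin

unbundle cardinal_syntax

text \<open>
  Cardinals are the relations \<open>r\<close> with \<^term>\<open>Card_order r\<close>, i.e. initial well-orders. The ordinals
  below \<open>r\<close> are the elements of \<^term>\<open>Field r\<close>, and \<open>a \<in> underS r b\<close> says \<open>a < b\<close>.
  A cardinal is determined only up to \<^term>\<open>ordIso2\<close>.
\<close>

definition is_card_sup :: "'b rel \<Rightarrow> 'i set \<Rightarrow> ('i \<Rightarrow> 'a rel) \<Rightarrow> bool" where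
  "is_card_sup s I m \<longleftrightarrow> Card_order s \<and> (\<forall>i\<in>I. m i \<le>o s) \<and>
     (\<forall>t :: 'b rel. Card_order t \<and> (\<forall>i\<in>I. m i \<le>o t) \<longrightarrow> s \<le>o t)"

text \<open>
  The least cardinal with the property \<open>P\<close>, taken among the cardinals on the type \<open>'x\<close>. Wherever it
  is used below, \<open>P\<close> says that some kind of sequence of distinct points of a set \<open>S\<close> does not exist,
  and \<open>'x\<close> is a type of cardinality at least that of the successor of \<open>S\<close>. So the least such cardinal is
  attained on \<open>'x\<close> and is also least among the cardinals on all other types.
\<close>

definition least_card :: "('x rel \<Rightarrow> bool) \<Rightarrow> 'x rel" where
  "least_card P = (SOME d. Card_order d \<and> P d \<and> (\<forall>e. Card_order e \<and> P e \<longrightarrow> d \<le>o e))"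

text \<open>\<open>incr_seq t P R f\<close>: the sequence \<open>f\<close> of length \<open>t\<close> in \<open>P\<close> satisfies \<open>a < b \<Longrightarrow> R (f a) (f b)\<close>.\<close>

definition incr_seq :: "'x rel \<Rightarrow> 'p set \<Rightarrow> ('p \<Rightarrow> 'p \<Rightarrow> bool) \<Rightarrow> ('x \<Rightarrow> 'p) \<Rightarrow> bool" where
  "incr_seq t P R f \<longleftrightarrow>
     (\<forall>a\<in>Field t. f a \<in> P) \<and> (\<forall>b\<in>Field t. \<forall>a\<in>underS t b. R (f a) (f b))"

definition Depth_plus :: "'p set \<Rightarrow> ('p \<Rightarrow> 'p \<Rightarrow> bool) \<Rightarrow> 'p set rel" where
  "Depth_plus P R = least_card (\<lambda>t. \<not> (\<exists>f. incr_seq t P R f))"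


subsection \<open>Clubs and accumulation points\<close>

text \<open>
  The non-emptiness condition excludes 0. A successor ordinal never qualifies, so
  \<open>acc_pts r (Field r)\<close> is the set of (nonzero) limit ordinals below \<open>r\<close>.
\<close>

definition acc_pts :: "'a rel \<Rightarrow> 'a set \<Rightarrow> 'a set" where
  "acc_pts r C = {d \<in> Field r. underS r d \<noteq> {} \<and>
     (\<forall>a\<in>underS r d. \<exists>c\<in>C \<inter> underS r d. a \<in> underS r c)}"

text \<open>\<^const>\<open>cofinal\<close> is unboundedness in the given order.\<close>

definition club :: "'a rel \<Rightarrow> 'a set \<Rightarrow> bool" where
  "club r C \<longleftrightarrow> C \<subseteq> Field r \<and> cofinal C r \<and> acc_pts r C \<subseteq> C"


subsection \<open>The depth cardinals\<close>

definition less_bd :: "'a rel \<Rightarrow> ('a \<Rightarrow> 'a) \<Rightarrow> ('a \<Rightarrow> 'a) \<Rightarrow> bool" where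
  "less_bd r f g \<longleftrightarrow> \<not> cofinal {i \<in> Field r. (g i, f i) \<in> r} r"

definition less_sets :: "'a rel \<Rightarrow> 'a set \<Rightarrow> 'a set \<Rightarrow> bool" where
  "less_sets r A B \<longleftrightarrow> cofinal (B - A) r \<and> \<not> cofinal (A - B) r"

text \<open>\<open>underS t b = under t a\<close> expresses \<open>b = a + 1\<close>.\<close>

definition acc_seq :: "'a rel \<Rightarrow> 'x rel \<Rightarrow> ('x \<Rightarrow> 'a set) \<Rightarrow> bool" where
  "acc_seq r t C \<longleftrightarrow>
     (\<forall>a\<in>Field t. \<forall>b\<in>Field t. underS t b = under t a \<longrightarrow> C b \<subseteq> acc_pts r (C a))"

text \<open>
  The cardinals with index 1, 2, 3 are given by \<open>Clubs\<close>, \<open>Functions\<close>, \<open>Sets\<close>.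

  For index 1 the condition is printed as \<open>|C\<^sub>a - C\<^sub>b| < r\<close> for \<open>a < b\<close>. Together with
  \<open>C\<^sub>a\<^sub>+\<^sub>1 \<subseteq> acc C\<^sub>a\<close> this excludes all sequences of length 2 or more, because \<open>C - acc C\<close> has \<open>r\<close> elements
  for every club \<open>C\<close>. The intended condition is that the sequence be almost decreasing,
  \<open>|C\<^sub>b - C\<^sub>a| < r\<close>. Here \<open>Clubs\<close> is the intended version, \<open>Clubs_printed\<close> the printed one.
\<close>

datatype depth_kind = Clubs | Clubs_printed | Functions | Sets

fun has_seq :: "depth_kind \<Rightarrow> 'a rel \<Rightarrow> 'x rel \<Rightarrow> bool" where
  "has_seq Clubs r t \<longleftrightarrow>
     (\<exists>C. incr_seq t {C. club r C} (\<lambda>A B. |B - A| <o r) C \<and> acc_seq r t C)"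
| "has_seq Clubs_printed r t \<longleftrightarrow>
     (\<exists>C. incr_seq t {C. club r C} (\<lambda>A B. |A - B| <o r) C \<and> acc_seq r t C)"
| "has_seq Functions r t \<longleftrightarrow>
     (\<exists>f. incr_seq t (Field r \<rightarrow> Field r) (less_bd r) f)"
| "has_seq Sets r t \<longleftrightarrow>
     (\<exists>A. incr_seq t {A. A \<subseteq> Field r \<and> cofinal A r} (less_sets r) A)"

text \<open>Meant for regular uncountable \<open>r\<close>. All values are at most the successor of \<open>2\<^sup>r\<close>.\<close>

definition dp :: "depth_kind \<Rightarrow> 'a rel \<Rightarrow> 'a set set rel" where
  "dp l r = least_card (\<lambda>t. \<not> has_seq l r t)"


subsection \<open>Normal filters\<close>

text \<open>
  A filter on the cardinal \<open>k\<close> is a filter on its type that contains \<^term>\<open>Field k\<close>. A normal filter is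
  proper, contains the complements of the bounded sets and is closed under diagonal intersections.
\<close>

definition normal_filter :: "'k rel \<Rightarrow> 'k filter \<Rightarrow> bool" where
  "normal_filter k D \<longleftrightarrow> D \<noteq> bot \<and> (\<forall>\<^sub>F i in D. i \<in> Field k) \<and>
     (\<forall>a\<in>Field k. \<forall>\<^sub>F i in D. a \<in> underS k i) \<and>
     (\<forall>P. (\<forall>a\<in>Field k. \<forall>\<^sub>F i in D. P a i) \<longrightarrow> (\<forall>\<^sub>F i in D. \<forall>a\<in>underS k i. P a i))"

end

theory Submission
  imports Defs
begin

text \<open>
  For functions \<open>u\<close> in the product of the \<open>\<lambda>\<^sub>i = \<mu>\<^sub>i\<^sup>+\<close>, let \<open>\<Phi> u\<close> be the Galvin--Hajnal rank of \<open>u\<close> in the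
  well-founded relation \<open><\<^sub>D\<close>. It is below \<open>\<lambda> = \<mu>\<^sup>+\<close>: otherwise there are \<open>\<mu>\<^sup>+\<close> functions \<open>v <\<^sub>D u\<close> of
  different ranks; by Fodor's lemma each \<open>v\<close> has its rank already on a positive set \<open>B\<close> on which a
  fixed regressive coding of the values below \<open>u i\<close> is constant, and as \<open>2\<^sup>\<kappa> < \<mu>\<close> and \<open>\<mu>\<^sub>i\<^sup>\<kappa> < \<mu>\<close> there
  are at most \<open>\<mu>\<close> such pieces \<open>v|B\<close>. Moreover every \<open>x\<close> in the product is \<open><\<^sub>D u\<close> as soon as \<open>\<Phi> u\<close> is
  large. So properties that hold in almost every \<open>\<lambda>\<^sub>i\<close> above a bound hold in \<open>\<lambda>\<close> above a bound, and a
  sequence \<open>g\<close> in the product of the \<open>\<theta>\<^sub>i\<close> combines given sequences \<open>F\<^sub>i\<close> of length \<open>\<theta>\<^sub>i\<close> in \<open>\<lambda>\<^sub>i\<close> into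
  one in \<open>\<lambda>\<close>: for functions, \<open>z \<mapsto> \<Phi> (i \<mapsto> F\<^sub>i (g\<^sub>a i) (f\<^sub>z i))\<close> where \<open>\<Phi> f\<^sub>z \<ge> z\<close>; for clubs, the closure of
  the set of all \<open>\<Phi> u\<close> with \<open>u\<close> in the product of the \<open>F\<^sub>i (g\<^sub>a i)\<close>; for unbounded sets, the set of all
  pieces that choose from the \<open>F\<^sub>i (g\<^sub>a i)\<close>.
\<close>


subsection \<open>Well-orders and cardinals\<close>

lemma wo_le_trans: "Well_order r \<Longrightarrow> (a, b) \<in> r \<Longrightarrow> (b, c) \<in> r \<Longrightarrow> (a, c) \<in> r"
  unfolding order_on_defs using transD[of r a b c] by simp

lemma wo_antisym: "Well_order r \<Longrightarrow> (a, b) \<in> r \<Longrightarrow> (b, a) \<in> r \<Longrightarrow> a = b"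
  unfolding order_on_defs using antisymD[of r a b] by simp

lemma wo_le_less_trans: "Well_order r \<Longrightarrow> (a, b) \<in> r \<Longrightarrow> b \<in> underS r c \<Longrightarrow> a \<in> underS r c"
  unfolding underS_def using wo_le_trans[of r a b c] wo_antisym[of r a b] by auto

lemma wo_less_le_trans: "Well_order r \<Longrightarrow> a \<in> underS r b \<Longrightarrow> (b, c) \<in> r \<Longrightarrow> a \<in> underS r c"
  unfolding underS_def using wo_le_trans[of r a b c] wo_antisym[of r a b] by auto

lemma wo_less_trans: "Well_order r \<Longrightarrow> a \<in> underS r b \<Longrightarrow> b \<in> underS r c \<Longrightarrow> a \<in> underS r c"
  using wo_less_le_trans[of r a b c] by (simp add: underS_def)

lemma wo_refl: "Well_order r \<Longrightarrow> a \<in> Field r \<Longrightarrow> (a, a) \<in> r"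
  unfolding order_on_defs using refl_onD[of "Field r" r a] by simp

lemma wo_le_or_less: "Well_order r \<Longrightarrow> a \<in> Field r \<Longrightarrow> b \<in> Field r \<Longrightarrow> (a, b) \<in> r \<or> b \<in> underS r a"
  using wo_rel.TOTALS[OF wo_rel.intro, of r] by (cases "a = b") (auto simp: underS_def wo_refl)

lemma wo_less_not_le: "Well_order r \<Longrightarrow> a \<in> underS r b \<Longrightarrow> (b, a) \<notin> r"
  unfolding underS_def using wo_antisym[of r a b] by auto

lemma underS_imp_le: "a \<in> underS r b \<Longrightarrow> (a, b) \<in> r"
  by (simp add: underS_def)

lemma less_Field1: "a \<in> underS r b \<Longrightarrow> a \<in> Field r"
  using underS_Field by fast

lemma less_Field2: "a \<in> underS r b \<Longrightarrow> b \<in> Field r"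
  using underS_empty by fast

lemma le_Field: "(a, b) \<in> r \<Longrightarrow> a \<in> Field r \<and> b \<in> Field r"
  by (auto simp: Field_def)

lemma wo_least:
  assumes "Well_order r" and "a \<in> Field r" and "P a"
  obtains b where "b \<in> Field r" "P b" "\<And>c. c \<in> underS r b \<Longrightarrow> \<not> P c" "\<And>c. c \<in> Field r \<Longrightarrow> P c \<Longrightarrow> (b, c) \<in> r"
proof -
  have "wf (r - Id)"
    using assms(1) by (simp add: order_on_defs)
  then obtain b where b: "b \<in> Field r \<and> P b" "\<And>c. (c, b) \<in> r - Id \<Longrightarrow> \<not> (c \<in> Field r \<and> P c)"
    using assms(2,3) wfE_min[of "r - Id" a "{b \<in> Field r. P b}"] by auto
  show thesis
  proof
    show "b \<in> Field r" "P b"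
      using b by auto
    show 1: "\<not> P c" if "c \<in> underS r b" for c
      using b(2)[of c] that less_Field1[OF that] by (auto simp: underS_def)
    show "(b, c) \<in> r" if "c \<in> Field r" "P c" for c
      using wo_le_or_less[OF assms(1) \<open>b \<in> Field r\<close> that(1)] 1 that(2) by blast
  qed
qed

lemma wo_induct [consumes 2, case_names less]:
  assumes "Well_order r" and "a \<in> Field r"
    and "\<And>a. a \<in> Field r \<Longrightarrow> (\<And>b. b \<in> underS r a \<Longrightarrow> P b) \<Longrightarrow> P a"
  shows "P a"
proof (rule ccontr)
  assume "\<not> P a"
  then obtain b where "b \<in> Field r" "\<not> P b" "\<And>c. c \<in> underS r b \<Longrightarrow> \<not> \<not> P c"
    using wo_least[OF assms(1,2), of "\<lambda>a. \<not> P a"] by blast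
  then show False
    using assms(3) by blast
qed

lemma Card_order_wo: "Card_order r \<Longrightarrow> Well_order r"
  by (rule card_order_on_well_order_on)

section \<open>Bounded and cofinal sets in regular and successor cardinals\<close>

lemma not_cofinalD:
  assumes "Well_order r" and "A \<subseteq> Field r" and "\<not> cofinal A r"
  obtains b where "b \<in> Field r" "\<And>a. a \<in> A \<Longrightarrow> (a, b) \<in> r"
proof -
  from assms(3) obtain b where b: "b \<in> Field r" "\<And>a. a \<in> A \<Longrightarrow> \<not> (b \<noteq> a \<and> (b, a) \<in> r)"
    unfolding cofinal_def by blast
  show thesis
  proof (rule that[OF b(1)])
    fix a assume "a \<in> A"
    then show "(a, b) \<in> r"
      using b wo_le_or_less[OF assms(1), of a b] assms(2) by (auto simp: underS_def)
  qed
qed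

lemma cofinal_underS: "cofinal A r \<longleftrightarrow> (\<forall>a\<in>Field r. \<exists>b\<in>A. a \<in> underS r b)"
  by (auto simp: cofinal_def underS_def)

lemma cofinal_mono: "cofinal A r \<Longrightarrow> A \<subseteq> B \<Longrightarrow> cofinal B r"
  unfolding cofinal_def by blast

lemma card_less_bounded:
  assumes r: "Card_order r" "regularCard r" and "infinite (Field r)"
    and "A \<subseteq> Field r" and "|A| <o r"
  obtains b where "b \<in> Field r" "\<And>a. a \<in> A \<Longrightarrow> a \<in> underS r b"
proof -
  have "\<not> cofinal A r"
    using assms unfolding regularCard_def using not_ordLess_ordIso by blast
  then obtain b where b: "b \<in> Field r" "\<And>a. a \<in> A \<Longrightarrow> (a, b) \<in> r"
    using not_cofinalD[OF Card_order_wo[OF r(1)] assms(4)] by blast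
  \<comment> \<open>Non-cofinality gives only the weak bound \<open>b\<close>; a point above
    \<open>b\<close> is a strict one.\<close>
  obtain c where "b \<noteq> c" "(b, c) \<in> r"
    using infinite_Card_order_limit[OF r(1) assms(3) b(1)] by blast
  then show thesis
    using that[of c] b wo_le_less_trans[OF Card_order_wo[OF r(1)], of _ b c] le_Field[of b c r]
    by (auto simp: underS_def)
qed

lemma cardSuc_bounded:
  assumes "Cinfinite s" and "A \<subseteq> Field (cardSuc s)" and "|A| \<le>o s"
  obtains b where "b \<in> Field (cardSuc s)" "\<And>a. a \<in> A \<Longrightarrow> a \<in> underS (cardSuc s) b"
proof (rule card_less_bounded)
  have "Cinfinite (cardSuc s)"
    using assms(1) by (rule Cinfinite_cardSuc)
  then show "Card_order (cardSuc s)" "infinite (Field (cardSuc s))"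
    by (auto simp: cinfinite_def)
  show "regularCard (cardSuc s)"
    using assms(1) by (rule regularCard_cardSuc)
  show "|A| <o cardSuc s"
    using assms(1,3) by (simp add: card_of_Card_order cardSuc_ordLeq_ordLess)
qed (use assms that in auto)

lemma cardSuc_underS:
  assumes "Card_order s" and "a \<in> Field (cardSuc s)"
  shows "|underS (cardSuc s) a| \<le>o s"
  using assms by (simp add: card_of_Card_order card_of_underS cardSuc_Card_order flip: cardSuc_ordLeq_ordLess)

text \<open>Every proper initial segment of a successor cardinal has size at most \<open>s\<close>,
  and the cardinal is regular. So unboundedness depends only on size, and any injection into the
  cardinal preserves it.\<close>

lemma cofinal_cardSuc:
  assumes "Cinfinite s" and "A \<subseteq> Field (cardSuc s)"
  shows "cofinal A (cardSuc s) \<longleftrightarrow> \<not> |A| \<le>o s"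
proof
  have wo: "Well_order (cardSuc s)"
    using assms by (simp add: cardSuc_Well_order)
  show "\<not> |A| \<le>o s" if "cofinal A (cardSuc s)"
  proof
    assume "|A| \<le>o s"
    then obtain b where b: "b \<in> Field (cardSuc s)" "\<And>a. a \<in> A \<Longrightarrow> a \<in> underS (cardSuc s) b"
      using assms cardSuc_bounded by blast
    then show False
      using that wo_less_not_le[OF wo] unfolding cofinal_def by blast
  qed
  show "cofinal A (cardSuc s)" if "\<not> |A| \<le>o s"
  proof (rule ccontr)
    assume "\<not> ?thesis"
    then obtain b where b: "b \<in> Field (cardSuc s)" "\<And>a. a \<in> A \<Longrightarrow> (a, b) \<in> cardSuc s"
      using not_cofinalD[OF wo assms(2)] by blast
    have inf: "Cinfinite (cardSuc s)"
      using assms(1) by (rule Cinfinite_cardSuc)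
    then obtain c where c: "b \<noteq> c" "(b, c) \<in> cardSuc s"
      using infinite_Card_order_limit[of "cardSuc s" b] b(1) by (auto simp: cinfinite_def)
    have "A \<subseteq> underS (cardSuc s) c"
      using wo_le_less_trans[OF wo b(2), of _ c] c by (auto simp: underS_def)
    then have "|A| \<le>o s"
      using cardSuc_underS[of s c] assms(1) c le_Field[of b c] card_of_mono1 ordLeq_transitive by blast
    then show False
      using that by blast
  qed
qed

lemma card_less_cofinal:
  assumes "Cinfinite s" and "A \<subseteq> Field (cardSuc s)"
  shows "|A| <o cardSuc s \<longleftrightarrow> \<not> cofinal A (cardSuc s)"
  using assms cofinal_cardSuc[OF assms]
  by (simp add: card_of_Card_order flip: cardSuc_ordLeq_ordLess)

text \<open>Otherwise |X| would bound all \<open>m i\<close>. The supremum is least among cardinals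
  on its own type, so \<open>X\<close> is first replaced by an equinumerous subset \<open>B\<close>
  of \<open>Field s\<close>.\<close>

lemma is_card_sup_less:
  fixes s :: "'b rel" and X :: "'x set"
  assumes "is_card_sup s I m" and "|X| <o s" and "\<And>i. i \<in> I \<Longrightarrow> Well_order (m i)"
  shows "\<exists>i\<in>I. |X| <o m i"
proof (rule ccontr)
  assume *: "\<not> ?thesis"
  obtain B where B: "B < Field s" "|X| =o |B|" "|B| <o s"
    using internalize_card_of_ordLess[of X s] assms(2) by auto
  have "m i \<le>o |B|" if "i \<in> I" for i
  proof -
    have "m i \<le>o |X|"
      using * that not_ordLess_iff_ordLeq[OF assms(3)[OF that] card_of_Well_order[of X]] by blast
    then show ?thesis
      using B(2) by (rule ordLeq_ordIso_trans)
  qed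
  then have "s \<le>o |B|"
    using assms(1) card_of_Card_order unfolding is_card_sup_def by blast
  then show False
    using B(3) not_ordLess_ordLeq by blast
qed

text \<open>The points with fewer than \<open>s\<close> predecessors form an initial segment. Were
  it longer than \<open>s\<close>, then \<open>s\<close> would be isomorphic to the part below one
  of its points, which has size less than \<open>s\<close>.\<close>

lemma small_initial_segment:
  assumes r: "Well_order r" and s: "Card_order s" and Y: "Y \<subseteq> {y \<in> Field r. |underS r y| <o s}"
  shows "|Y| \<le>o s"
proof -
  let ?Y = "{y \<in> Field r. |underS r y| <o s}"
  have of: "wo_rel.ofilter r ?Y"
    unfolding wo_rel.ofilter_def[OF wo_rel.intro[OF r]]
  proof safe
    fix y x assume "|underS r y| <o s" and x: "x \<in> under r y"
    moreover have "underS r x \<subseteq> underS r y"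
      using x wo_less_le_trans[OF r] by (auto simp: under_def)
    ultimately show "|underS r x| <o s"
      using card_of_mono1 ordLeq_ordLess_trans by blast
  qed (auto simp: under_def Field_def)
  have R: "Well_order (Restr r ?Y)"
    using r by (rule Well_order_Restr)
  have F: "Field (Restr r ?Y) = ?Y"
    using r of by (rule Field_Restr_ofilter)
  have "Restr r ?Y \<le>o s"
  proof (rule ccontr)
    assume "\<not> Restr r ?Y \<le>o s"
    then have "s <o Restr r ?Y"
      using R s by (simp add: Card_order_wo not_ordLeq_iff_ordLess)
    then obtain y where y: "y \<in> ?Y" "s =o Restr (Restr r ?Y) (underS (Restr r ?Y) y)"
      unfolding ordLess_iff_ordIso_Restr[OF R Card_order_wo[OF s]] F by blast
    have "|Field s| =o |Field (Restr (Restr r ?Y) (underS (Restr r ?Y) y))|"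
      using y(2) by (rule card_of_cong)
    also have "|Field (Restr (Restr r ?Y) (underS (Restr r ?Y) y))| \<le>o |underS r y|"
      by (rule card_of_mono1) (auto simp: Field_def underS_def)
    also have "|underS r y| <o s"
      using y(1) by simp
    finally have "|Field s| <o s" .
    then show False
      using card_of_Field_ordIso[OF s] not_ordLess_ordIso[of "|Field s|" s] by simp
  qed
  then have "|?Y| \<le>o |Field s|"
    using card_of_mono2[of "Restr r ?Y" s] unfolding F by blast
  then have "|?Y| \<le>o s"
    using card_of_Field_ordIso[OF s] by (rule ordLeq_ordIso_trans)
  then show ?thesis
    using card_of_mono1[OF Y] ordLeq_transitive by blast
qed

text \<open>Inject \<open>X\<close> into \<open>s\<close> and let \<open>h x\<close> be an index for
  which \<open>m (h x)\<close> exceeds the number of predecessors of the image of \<open>x\<close>.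
  The points with \<open>m (h x)\<close> at most \<open>m i\<close> are then mapped to points with
  fewer than \<open>m i\<close> predecessors.\<close>

lemma small_cover:
  assumes "is_card_sup s I m" and "\<And>i. i \<in> I \<Longrightarrow> Card_order (m i)" and "|X| \<le>o s"
  obtains h where "\<And>x. x \<in> X \<Longrightarrow> h x \<in> I"
    "\<And>i. i \<in> I \<Longrightarrow> |{x \<in> X. m (h x) \<le>o m i}| \<le>o m i"
proof -
  have s: "Card_order s"
    using assms(1) by (simp add: is_card_sup_def)
  obtain e where e: "inj_on e X" "e ` X \<subseteq> Field s"
    using ordLeq_ordIso_trans[OF assms(3) ordIso_symmetric[OF card_of_Field_ordIso[OF s]]]
    unfolding card_of_ordLeq[symmetric] by blast
  have "\<exists>i\<in>I. |underS s (e x)| <o m i" if "x \<in> X" for x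
    using is_card_sup_less[OF assms(1) card_of_underS[OF s]] that e(2) assms(2) Card_order_wo by blast
  then obtain h where h: "\<And>x. x \<in> X \<Longrightarrow> h x \<in> I \<and> |underS s (e x)| <o m (h x)"
    by metis
  show thesis
  proof
    show "h x \<in> I" if "x \<in> X" for x
      using h that by blast
    fix i assume i: "i \<in> I"
    let ?Z = "{x \<in> X. m (h x) \<le>o m i}"
    have "e ` ?Z \<subseteq> {y \<in> Field s. |underS s y| <o m i}"
      using e(2) h ordLess_ordLeq_trans by blast
    then have "|e ` ?Z| \<le>o m i"
      using small_initial_segment Card_order_wo[OF s] assms(2)[OF i] by blast
    moreover have "|?Z| \<le>o |e ` ?Z|"
      using card_of_ordLeqI[of e ?Z "e ` ?Z"] e(1) inj_on_subset[of e X ?Z] by auto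
    ultimately show "|?Z| \<le>o m i"
      using ordLeq_transitive by blast
  qed
qed


subsection \<open>The product of the successor cardinals modulo a normal filter\<close>

locale card_scale =
  fixes \<kappa> :: "'k rel"
    and m :: "'k \<Rightarrow> 'a rel"
    and \<mu> :: "'m rel"
    and D :: "'k filter"
  assumes card_\<kappa>: "Card_order \<kappa>" and reg_\<kappa>: "regularCard \<kappa>" and unc_\<kappa>: "natLeq <o \<kappa>"
    and inf_m: "\<And>i. i \<in> Field \<kappa> \<Longrightarrow> Cinfinite (m i)"
    and strict_m: "\<And>i j. j \<in> Field \<kappa> \<Longrightarrow> i \<in> underS \<kappa> j \<Longrightarrow> m i <o m j"
    and cont_m: "\<And>j. j \<in> acc_pts \<kappa> (Field \<kappa>) \<Longrightarrow> is_card_sup (m j) (underS \<kappa> j) m"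
    and sup_m: "is_card_sup \<mu> (Field \<kappa>) m"
    and pow_\<kappa>: "ctwo ^c \<kappa> <o \<mu>"
    and exp_m: "\<And>i. i \<in> Field \<kappa> \<Longrightarrow> m i ^c \<kappa> <o \<mu>"
    and normal: "normal_filter \<kappa> D"
begin

abbreviation L :: "'k \<Rightarrow> 'a set rel" where
  "L i \<equiv> cardSuc (m i)"

abbreviation \<Lambda> :: "'m set rel" where
  "\<Lambda> \<equiv> cardSuc \<mu>"

text \<open>Values off \<open>Field \<kappa>\<close> are left free, since comparisons are modulo
  \<open>D\<close>, which contains \<open>Field \<kappa>\<close>.\<close>

definition Prd :: "('k \<Rightarrow> 'a set) set" where
  "Prd = {u. \<forall>i\<in>Field \<kappa>. u i \<in> Field (L i)}"

text \<open>Comparison modulo the filter generated by \<open>D\<close> and \<open>A\<close>; this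
  filter is proper exactly when \<open>A\<close> is positive.\<close>

definition lt_on :: "'k set \<Rightarrow> ('k \<Rightarrow> 'a set) \<Rightarrow> ('k \<Rightarrow> 'a set) \<Rightarrow> bool" where
  "lt_on A u v \<longleftrightarrow> (\<forall>\<^sub>F i in D. i \<in> A \<longrightarrow> u i \<in> underS (L i) (v i))"

definition le_on :: "'k set \<Rightarrow> ('k \<Rightarrow> 'a set) \<Rightarrow> ('k \<Rightarrow> 'a set) \<Rightarrow> bool" where
  "le_on A u v \<longleftrightarrow> (\<forall>\<^sub>F i in D. i \<in> A \<longrightarrow> (u i, v i) \<in> L i)"

abbreviation positive :: "'k set \<Rightarrow> bool" where
  "positive A \<equiv> \<exists>\<^sub>F i in D. i \<in> A"

abbreviation limits :: "'k set" where
  "limits \<equiv> acc_pts \<kappa> (Field \<kappa>)"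

section \<open>Cardinal bounds from the hypotheses on \<kappa>, \<mu> and the sequence
  \<open>m\<close>\<close>

lemma wo_\<kappa>: "Well_order \<kappa>"
  using card_\<kappa> by (rule Card_order_wo)

lemma inf_\<kappa>: "infinite (Field \<kappa>)"
proof -
  have "natLeq \<le>o \<kappa>"
    using unc_\<kappa> by (rule ordLess_imp_ordLeq)
  then show ?thesis
    using infinite_iff_natLeq_ordLeq card_of_mono2[of natLeq \<kappa>] Field_natLeq
      card_of_ordLeq_infinite[of "UNIV :: nat set" "Field \<kappa>"] by auto
qed

lemma card_m: "i \<in> Field \<kappa> \<Longrightarrow> Card_order (m i)"
  using inf_m by blast

lemma card_\<mu>: "Card_order \<mu>"
  using sup_m by (simp add: is_card_sup_def)

lemma m_le_\<mu>: "i \<in> Field \<kappa> \<Longrightarrow> m i \<le>o \<mu>"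
  using sup_m by (simp add: is_card_sup_def)

lemma inf_\<mu>: "Cinfinite \<mu>"
proof -
  obtain i where "i \<in> Field \<kappa>"
    using inf_\<kappa> by (metis ex_in_conv finite.emptyI)
  then show ?thesis
    using cinfinite_mono[OF m_le_\<mu>] inf_m card_\<mu> by blast
qed

lemma \<kappa>_le_\<mu>: "|Field \<kappa>| \<le>o \<mu>"
proof -
  have "|Field \<kappa>| =o \<kappa>"
    using card_\<kappa> by (rule card_of_Field_ordIso)
  also have "\<kappa> <o ctwo ^c \<kappa>"
    using card_\<kappa> by (rule ordLess_ctwo_cexp)
  also have "ctwo ^c \<kappa> <o \<mu>"
    by (rule pow_\<kappa>)
  finally show ?thesis
    by (rule ordLess_imp_ordLeq)
qed

lemma Pow_le_\<mu>: "|Pow (Field \<kappa>)| \<le>o \<mu>"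
proof -
  have "|Pow (Field \<kappa>)| =o ctwo ^c \<kappa>"
    using card_of_Pow_Func[of "Field \<kappa>"] by (simp add: cexp_def ctwo_def Field_card_of)
  also have "ctwo ^c \<kappa> <o \<mu>"
    by (rule pow_\<kappa>)
  finally show ?thesis
    by (rule ordLess_imp_ordLeq)
qed

lemma wo_L: "i \<in> Field \<kappa> \<Longrightarrow> Well_order (L i)"
  using inf_m by (simp add: cardSuc_Well_order)

lemma wo_\<Lambda>: "Well_order \<Lambda>"
  using card_\<mu> by (simp add: cardSuc_Well_order)

lemma L_bounded:
  assumes "i \<in> Field \<kappa>" and "A \<subseteq> Field (L i)" and "|A| \<le>o m i"
  obtains b where "b \<in> Field (L i)" "\<And>a. a \<in> A \<Longrightarrow> a \<in> underS (L i) b"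
  using cardSuc_bounded[OF inf_m[OF assms(1)] assms(2,3)] by blast

lemma \<Lambda>_bounded:
  assumes "A \<subseteq> Field \<Lambda>" and "|A| \<le>o \<mu>"
  obtains b where "b \<in> Field \<Lambda>" "\<And>a. a \<in> A \<Longrightarrow> a \<in> underS \<Lambda> b"
  using cardSuc_bounded[OF inf_\<mu> assms] by blast

lemma \<kappa>_no_max: "i \<in> Field \<kappa> \<Longrightarrow> \<exists>j. i \<in> underS \<kappa> j"
  using infinite_Card_order_limit[OF card_\<kappa> inf_\<kappa>, of i] by (auto simp: underS_def)

section \<open>Consequences of normality\<close>

lemma ev_Field: "\<forall>\<^sub>F i in D. i \<in> Field \<kappa>"
  using normal by (simp add: normal_filter_def)

lemma ev_tail: "a \<in> Field \<kappa> \<Longrightarrow> \<forall>\<^sub>F i in D. a \<in> underS \<kappa> i"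
  using normal by (simp add: normal_filter_def)

lemma ev_diag: "(\<And>a. a \<in> Field \<kappa> \<Longrightarrow> \<forall>\<^sub>F i in D. P a i) \<Longrightarrow> \<forall>\<^sub>F i in D. \<forall>a\<in>underS \<kappa> i. P a i"
  using normal by (simp add: normal_filter_def)

lemma positive_UNIV: "positive UNIV"
  using normal by (simp add: normal_filter_def trivial_limit_def frequently_def)

text \<open>For each \<open>a\<close>, almost every \<open>i\<close> lies above some
  \<open>b\<close> that is above \<open>a\<close>. Nonzero points in the diagonal intersection of
  these sets are limits.\<close>

lemma ev_limits: "\<forall>\<^sub>F i in D. i \<in> limits"
proof -
  obtain a where a: "a \<in> Field \<kappa>"
    using inf_\<kappa> by (metis ex_in_conv finite.emptyI)
  have "\<forall>\<^sub>F i in D. \<exists>b\<in>underS \<kappa> i. a \<in> underS \<kappa> b" if a: "a \<in> Field \<kappa>" for a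
  proof -
    obtain b where b: "a \<in> underS \<kappa> b"
      using \<kappa>_no_max[OF a] by blast
    show ?thesis
      using ev_tail[OF less_Field2[OF b]] by eventually_elim (use b in blast)
  qed
  then have "\<forall>\<^sub>F i in D. \<forall>a\<in>underS \<kappa> i. \<exists>b\<in>underS \<kappa> i. a \<in> underS \<kappa> b"
    by (rule ev_diag)
  with ev_tail[OF a] ev_Field show ?thesis
  proof eventually_elim
    case (elim i)
    then show ?case
      unfolding acc_pts_def using less_Field1 by fast
  qed
qed

text \<open>If every fibre of the regressive function were null, the diagonal intersection of the
  complements would avoid \<open>A\<close>.\<close>

lemma fodor:
  assumes "\<forall>\<^sub>F i in D. i \<in> A \<longrightarrow> j i \<in> underS \<kappa> i" and "positive A"
  shows "\<exists>a\<in>Field \<kappa>. positive {i \<in> A. j i = a}"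
proof (rule ccontr)
  assume *: "\<not> ?thesis"
  have "\<forall>\<^sub>F i in D. \<not> (i \<in> A \<and> j i = a)" if "a \<in> Field \<kappa>" for a
    using that * by (auto simp: not_frequently)
  then have "\<forall>\<^sub>F i in D. \<forall>a\<in>underS \<kappa> i. \<not> (i \<in> A \<and> j i = a)"
    by (rule ev_diag)
  with assms(1) have "\<forall>\<^sub>F i in D. \<not> i \<in> A"
    by eventually_elim blast
  then show False
    using assms(2) by (simp add: frequently_def)
qed

text \<open>Indexing the conditions by a countable subset of \<kappa>, which is bounded because
  \<kappa> is regular and uncountable, makes their conjunction a diagonal intersection beyond the
  bound.\<close>

lemma ev_countable:
  assumes "\<And>n :: nat. \<forall>\<^sub>F i in D. P n i"
  shows "\<forall>\<^sub>F i in D. \<forall>n. P n i"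
proof -
  obtain e :: "nat \<Rightarrow> 'k" where e: "inj e" "range e \<subseteq> Field \<kappa>"
    using inf_\<kappa> infinite_countable_subset by blast
  have "|range e| \<le>o |UNIV :: nat set|"
    by (rule card_of_image)
  also have "|UNIV :: nat set| =o natLeq"
    by (rule card_of_nat)
  also have "natLeq <o \<kappa>"
    by (rule unc_\<kappa>)
  finally have "|range e| <o \<kappa>" .
  then obtain b where b: "b \<in> Field \<kappa>" "\<And>x. x \<in> range e \<Longrightarrow> x \<in> underS \<kappa> b"
    by (rule card_less_bounded[OF card_\<kappa> reg_\<kappa> inf_\<kappa> e(2)]) (rule that)
  have "\<forall>\<^sub>F i in D. \<forall>a\<in>underS \<kappa> i. \<forall>n. e n = a \<longrightarrow> P n i"
  proof (rule ev_diag)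
    fix a
    show "\<forall>\<^sub>F i in D. \<forall>n. e n = a \<longrightarrow> P n i"
    proof (cases "a \<in> range e")
      case True
      then obtain n where "a = e n"
        by blast
      then show ?thesis
        using assms[of n] e(1) by (simp add: inj_eq)
    next
      case False
      then show ?thesis
        by (intro always_eventually) auto
    qed
  qed
  with ev_tail[OF b(1)] show ?thesis
  proof eventually_elim
    case (elim i)
    then show ?case
      using wo_less_trans[OF wo_\<kappa> b(2)] by auto
  qed
qed

text \<open>Coordinate \<open>i\<close> takes account only of the functions \<open>w\<close> with
  \<open>m (h w)\<close> at most \<open>m i\<close>. These number at most \<open>m i\<close>, hence
  are bounded in \<open>L i\<close>, and each \<open>w\<close> is included at all \<open>i\<close>
  above \<open>h w\<close>.\<close>

lemma common_bound:
  assumes "W \<subseteq> Prd" and "|W| \<le>o \<mu>"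
  obtains v where "v \<in> Prd" "\<And>w. w \<in> W \<Longrightarrow> lt_on UNIV w v"
proof -
  obtain h where h: "\<And>w. w \<in> W \<Longrightarrow> h w \<in> Field \<kappa>"
    "\<And>i. i \<in> Field \<kappa> \<Longrightarrow> |{w \<in> W. m (h w) \<le>o m i}| \<le>o m i"
    using small_cover[OF sup_m card_m assms(2)] by blast
  have "\<exists>b\<in>Field (L i). \<forall>w\<in>W. m (h w) \<le>o m i \<longrightarrow> w i \<in> underS (L i) b" if i: "i \<in> Field \<kappa>" for i
  proof -
    let ?W = "{w \<in> W. m (h w) \<le>o m i}"
    have "|(\<lambda>w. w i) ` ?W| \<le>o m i"
      using ordLeq_transitive[OF card_of_image h(2)[OF i]] .
    moreover have "(\<lambda>w. w i) ` ?W \<subseteq> Field (L i)"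
      using assms(1) i by (auto simp: Prd_def)
    ultimately obtain b where "b \<in> Field (L i)" "\<And>x. x \<in> (\<lambda>w. w i) ` ?W \<Longrightarrow> x \<in> underS (L i) b"
      using L_bounded[OF i] by blast
    then show ?thesis
      by blast
  qed
  then obtain v where v: "\<And>i. i \<in> Field \<kappa> \<Longrightarrow> v i \<in> Field (L i)"
    "\<And>i w. i \<in> Field \<kappa> \<Longrightarrow> w \<in> W \<Longrightarrow> m (h w) \<le>o m i \<Longrightarrow> w i \<in> underS (L i) (v i)"
    by metis
  show thesis
  proof
    show "v \<in> Prd"
      using v(1) by (simp add: Prd_def)
    fix w assume w: "w \<in> W"
    show "lt_on UNIV w v"
      unfolding lt_on_def using ev_tail[OF h(1)[OF w]] ev_Field
    proof eventually_elim
      case (elim i)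
      then show ?case
        using v(2)[OF elim(2) w ordLess_imp_ordLeq[OF strict_m]] by blast
    qed
  qed
qed

text \<open>
  \<open>press u i\<close> is the regressive coding: for limit \<open>i\<close> it sorts the at most \<open>m i\<close> values below \<open>u i\<close> into
  boxes indexed by the \<open>a\<close> below \<open>i\<close>, where the box of \<open>a\<close> has at most \<open>m a\<close> elements.
\<close>

definition press :: "('k \<Rightarrow> 'a set) \<Rightarrow> 'k \<Rightarrow> 'a set \<Rightarrow> 'k" where
  "press u i = (SOME h. (\<forall>x\<in>underS (L i) (u i). h x \<in> underS \<kappa> i) \<and>
     (\<forall>a\<in>underS \<kappa> i. |{x \<in> underS (L i) (u i). h x = a}| \<le>o m a))"

lemma press:
  assumes "u \<in> Prd" and "i \<in> limits"
  shows "x \<in> underS (L i) (u i) \<Longrightarrow> press u i x \<in> underS \<kappa> i"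
    and "a \<in> underS \<kappa> i \<Longrightarrow> |{x \<in> underS (L i) (u i). press u i x = a}| \<le>o m a"
proof -
  let ?P = "\<lambda>h. (\<forall>x\<in>underS (L i) (u i). h x \<in> underS \<kappa> i) \<and>
     (\<forall>a\<in>underS \<kappa> i. |{x \<in> underS (L i) (u i). h x = a}| \<le>o m a)"
  have i: "i \<in> Field \<kappa>"
    using assms(2) by (simp add: acc_pts_def)
  have mc: "Card_order (m a)" if "a \<in> underS \<kappa> i" for a
    using card_m less_Field1[OF that] .
  have "|underS (L i) (u i)| \<le>o m i"
    using cardSuc_underS[OF card_m[OF i]] assms(1) i by (auto simp: Prd_def)
  then obtain h where h: "\<And>x. x \<in> underS (L i) (u i) \<Longrightarrow> h x \<in> underS \<kappa> i"
    "\<And>a. a \<in> underS \<kappa> i \<Longrightarrow> |{x \<in> underS (L i) (u i). m (h x) \<le>o m a}| \<le>o m a"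
    using small_cover[OF cont_m[OF assms(2)] mc] by blast
  have "|{x \<in> underS (L i) (u i). h x = a}| \<le>o m a" if a: "a \<in> underS \<kappa> i" for a
  proof -
    have "{x \<in> underS (L i) (u i). h x = a} \<subseteq> {x \<in> underS (L i) (u i). m (h x) \<le>o m a}"
      using ordLeq_refl[OF mc[OF a]] by blast
    then show ?thesis
      using ordLeq_transitive[OF card_of_mono1 h(2)[OF a]] by blast
  qed
  then have "?P h"
    using h(1) by blast
  then have "?P (press u i)"
    unfolding press_def by (rule someI[of ?P])
  then show "x \<in> underS (L i) (u i) \<Longrightarrow> press u i x \<in> underS \<kappa> i"
    and "a \<in> underS \<kappa> i \<Longrightarrow> |{x \<in> underS (L i) (u i). press u i x = a}| \<le>o m a"
    by blast+
qed

definition pieces :: "('k \<Rightarrow> 'a set) \<Rightarrow> 'k \<Rightarrow> ('k set \<times> ('k \<Rightarrow> 'a set)) set" where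
  "pieces u a = {(B, v). B \<subseteq> limits \<and>
     (\<forall>i\<in>B. a \<in> underS \<kappa> i \<and> v i \<in> underS (L i) (u i) \<and> press u i (v i) = a)}"

text \<open>A piece is determined by its domain and by its values, which lie in boxes of size at
  most \<open>m a\<close>. This leaves at most \<open>2^\<kappa>\<close> times
  \<open>(m a)^\<kappa>\<close> possibilities.\<close>

lemma card_pieces_at:
  assumes u: "u \<in> Prd" and a: "a \<in> Field \<kappa>" and V: "V \<subseteq> pieces u a"
    and distinct: "\<And>B v w. (B, v) \<in> V \<Longrightarrow> (B, w) \<in> V \<Longrightarrow> (\<And>i. i \<in> B \<Longrightarrow> v i = w i) \<Longrightarrow> v = w"
  shows "|V| \<le>o \<mu>"
proof -
  let ?X = "\<lambda>i. {x \<in> underS (L i) (u i). press u i x = a}"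
  have "\<exists>e. inj_on e (?X i) \<and> e ` ?X i \<subseteq> Field (m a)" if "i \<in> limits" "a \<in> underS \<kappa> i" for i
    using ordLeq_ordIso_trans[OF press(2)[OF u that] ordIso_symmetric[OF card_of_Field_ordIso[OF card_m[OF a]]]]
    unfolding card_of_ordLeq[symmetric] .
  then have "\<forall>i. \<exists>e. i \<in> limits \<longrightarrow> a \<in> underS \<kappa> i \<longrightarrow> inj_on e (?X i) \<and> e ` ?X i \<subseteq> Field (m a)"
    by simp
  from choice[OF this] obtain e
    where e: "\<And>i. i \<in> limits \<Longrightarrow> a \<in> underS \<kappa> i \<Longrightarrow> inj_on (e i) (?X i) \<and> e i ` ?X i \<subseteq> Field (m a)"
    by auto
  \<comment> \<open>A filler value off \<open>B\<close>; nothing is lost, as \<open>code\<close>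
    also records \<open>B\<close>.\<close>
  obtain d where d: "d \<in> Field (m a)"
    using inf_m[OF a] unfolding cinfinite_def by (metis ex_in_conv finite.emptyI)
  define code where "code = (\<lambda>(B, v). (B, \<lambda>i. if i \<in> Field \<kappa> then if i \<in> B then e i (v i) else d else undefined))"
  have "inj_on code V"
  proof (rule inj_onI)
    fix p q assume pq: "p \<in> V" "q \<in> V" "code p = code q"
    obtain B v C w where [simp]: "p = (B, v)" "q = (C, w)"
      by fastforce
    have [simp]: "C = B"
      using pq(3) by (simp add: code_def)
    have "v i = w i" if i: "i \<in> B" for i
    proof -
      have lim: "i \<in> limits" "a \<in> underS \<kappa> i" and X: "v i \<in> ?X i" "w i \<in> ?X i"
        using pq(1,2) V i by (auto simp: pieces_def)
      have "snd (code p) i = snd (code q) i"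
        using pq(3) by simp
      then have "e i (v i) = e i (w i)"
        using i less_Field2[OF lim(2)] by (simp add: code_def)
      with X show ?thesis
        using inj_onD[OF conjunct1[OF e[OF lim]]] by blast
    qed
    then show "p = q"
      using distinct pq(1,2) by simp
  qed
  moreover have "code ` V \<subseteq> Pow (Field \<kappa>) \<times> Func (Field \<kappa>) (Field (m a))"
  proof safe
    fix B v C f assume "(B, v) \<in> V" and "(C, f) = code (B, v)"
    then have *: "(B, v) \<in> pieces u a" "C = B"
        "f = (\<lambda>i. if i \<in> Field \<kappa> then if i \<in> B then e i (v i) else d else undefined)"
      using V by (auto simp: code_def)
    show "x \<in> Field \<kappa>" if "x \<in> C" for x
      using *(1,2) that less_Field2 by (fastforce simp: pieces_def)
    have "e i (v i) \<in> Field (m a)" if "i \<in> B" for i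
      using *(1) that e[of i] by (auto simp: pieces_def)
    then show "f \<in> Func (Field \<kappa>) (Field (m a))"
      using d by (auto simp: Func_def *(3))
  qed
  ultimately have "|V| \<le>o |Pow (Field \<kappa>) \<times> Func (Field \<kappa>) (Field (m a))|"
    unfolding card_of_ordLeq[symmetric] by blast
  moreover have "|Func (Field \<kappa>) (Field (m a))| \<le>o \<mu>"
    using ordLess_imp_ordLeq[OF exp_m[OF a]] by (simp add: cexp_def)
  then have "|Pow (Field \<kappa>) \<times> Func (Field \<kappa>) (Field (m a))| \<le>o \<mu>"
    using card_of_Times_ordLeq_infinite_Field[OF _ Pow_le_\<mu> _ card_\<mu>] inf_\<mu>
    by (auto simp: cinfinite_def)
  ultimately show ?thesis
    by (rule ordLeq_transitive)
qed

lemma card_pieces: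
  assumes u: "u \<in> Prd" and V: "V \<subseteq> (\<Union>a\<in>Field \<kappa>. pieces u a)"
    and distinct: "\<And>B v w. (B, v) \<in> V \<Longrightarrow> (B, w) \<in> V \<Longrightarrow> (\<And>i. i \<in> B \<Longrightarrow> v i = w i) \<Longrightarrow> v = w"
  shows "|V| \<le>o \<mu>"
proof -
  have "V = (\<Union>a\<in>Field \<kappa>. V \<inter> pieces u a)"
    using V by blast
  moreover have "|\<Union>a\<in>Field \<kappa>. V \<inter> pieces u a| \<le>o \<mu>"
  proof (intro UNION_Cinfinite_bound ballI)
    fix a assume "a \<in> Field \<kappa>"
    then show "|V \<inter> pieces u a| \<le>o \<mu>"
      by (rule card_pieces_at[OF u]) (use distinct in blast)+
  qed (use \<kappa>_le_\<mu> inf_\<mu> in auto)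
  ultimately show ?thesis
    by simp
qed

end


subsection \<open>The rank function\<close>

context card_scale
begin

text \<open>\<open>rk A z u\<close>: the rank of \<open>u\<close> in the relation \<open>lt_on A\<close> is at most \<open>z\<close>.\<close>

inductive rk :: "'k set \<Rightarrow> 'm set \<Rightarrow> ('k \<Rightarrow> 'a set) \<Rightarrow> bool" for A where
  rk: "z \<in> Field \<Lambda> \<Longrightarrow> (\<And>v. v \<in> Prd \<Longrightarrow> lt_on A v u \<Longrightarrow> \<exists>y\<in>underS \<Lambda> z. rk A y v) \<Longrightarrow> rk A z u"

lemma rk_Field: "rk A z u \<Longrightarrow> z \<in> Field \<Lambda>"
  by (erule rk.cases) simp

lemma rkD: "rk A z u \<Longrightarrow> v \<in> Prd \<Longrightarrow> lt_on A v u \<Longrightarrow> \<exists>y\<in>underS \<Lambda> z. rk A y v"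
  by (erule rk.cases) simp

section \<open>Transitivity and monotonicity of ranks\<close>

lemma le_lt_on_trans:
  assumes "le_on B u v" and "lt_on A w u" and "\<forall>\<^sub>F i in D. i \<in> B \<longrightarrow> i \<in> A"
  shows "lt_on B w v"
  unfolding lt_on_def using assms[unfolded lt_on_def le_on_def] ev_Field
proof eventually_elim
  case (elim i)
  then show ?case
    using wo_less_le_trans[OF wo_L, of i "w i" "u i" "v i"] by blast
qed

lemma lt_le_on_trans:
  assumes "lt_on A u v" and "le_on A v w"
  shows "lt_on A u w"
  unfolding lt_on_def using assms[unfolded lt_on_def le_on_def] ev_Field
proof eventually_elim
  case (elim i)
  then show ?case
    using wo_less_le_trans[OF wo_L, of i "u i" "v i" "w i"] by blast
qed

lemma lt_on_trans:
  assumes "lt_on A u v" and "lt_on A v w"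
  shows "lt_on A u w"
  unfolding lt_on_def using assms[unfolded lt_on_def] ev_Field
proof eventually_elim
  case (elim i)
  then show ?case
    using wo_less_trans[OF wo_L, of i "u i" "v i" "w i"] by blast
qed

lemma lt_imp_le_on: "lt_on A u v \<Longrightarrow> le_on A u v"
  unfolding lt_on_def le_on_def by (erule eventually_mono) (simp add: underS_imp_le)

lemma le_on_refl: "u \<in> Prd \<Longrightarrow> le_on A u u"
  unfolding le_on_def using ev_Field by eventually_elim (auto simp: Prd_def intro: wo_refl wo_L)

text \<open>Enlarging the domain strengthens the relation, and lowering the function removes
  predecessors; both can only decrease the rank.\<close>

lemma rk_mono:
  assumes "rk B z u" and "le_on B v u" and "\<forall>\<^sub>F i in D. i \<in> B \<longrightarrow> i \<in> A"
  shows "rk A z v"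
  using assms(1,2)
proof (induction arbitrary: v)
  case (rk z u)
  show ?case
  proof (rule rk.rk)
    fix w assume w: "w \<in> Prd" "lt_on A w v"
    then have "lt_on B w u"
      using le_lt_on_trans rk.prems assms(3) by blast
    with w(1) rk.IH le_on_refl[OF w(1)] show "\<exists>y\<in>underS \<Lambda> z. rk A y w"
      by blast
  qed (rule rk.hyps)
qed

text \<open>
  A set that is the diagonal union of sets \<open>B\<close> gives a rank that is the minimum of the ranks for
  the \<open>B\<close>: witnesses against the \<open>B\<close> are glued, by normality, to one against the whole set.
\<close>

lemma rk_split:
  assumes "rk A z u" and "u \<in> Prd" and j: "\<forall>\<^sub>F i in D. i \<in> A \<longrightarrow> j i \<in> underS \<kappa> i"
  shows "\<exists>a\<in>Field \<kappa>. rk {i \<in> A. j i = a} z u"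
  using assms(1,2)
proof induction
  case (rk z u)
  let ?B = "\<lambda>a. {i \<in> A. j i = a}"
  show ?case
  proof (rule ccontr)
    assume no: "\<not> ?thesis"
    have "\<exists>v\<in>Prd. lt_on (?B a) v u \<and> (\<forall>y\<in>underS \<Lambda> z. \<not> rk (?B a) y v)" if a: "a \<in> Field \<kappa>" for a
    proof (rule ccontr)
      assume "\<not> ?thesis"
      then have "rk (?B a) z u"
        using rk.hyps by (intro rk.rk) blast+
      then show False
        using no a by blast
    qed
    then have "\<forall>a. \<exists>v. a \<in> Field \<kappa> \<longrightarrow> v \<in> Prd \<and> lt_on (?B a) v u \<and> (\<forall>y\<in>underS \<Lambda> z. \<not> rk (?B a) y v)"
      by blast
    from choice[OF this] obtain V where V: "\<And>a. a \<in> Field \<kappa> \<Longrightarrow> V a \<in> Prd"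
      "\<And>a. a \<in> Field \<kappa> \<Longrightarrow> lt_on (?B a) (V a) u"
      "\<And>a y. a \<in> Field \<kappa> \<Longrightarrow> y \<in> underS \<Lambda> z \<Longrightarrow> \<not> rk (?B a) y (V a)"
      by blast
    define v where "v i = (if j i \<in> Field \<kappa> then V (j i) i else u i)" for i
    have v: "v \<in> Prd"
      using V(1) rk.prems by (auto simp: Prd_def v_def)
    have "\<forall>\<^sub>F i in D. \<forall>a\<in>underS \<kappa> i. i \<in> ?B a \<longrightarrow> V a i \<in> underS (L i) (u i)"
      using V(2) unfolding lt_on_def by (rule ev_diag)
    then have "lt_on A v u"
      unfolding lt_on_def using j
      by eventually_elim (use less_Field1 in \<open>fastforce simp: v_def\<close>)
    then obtain y a where ya: "y \<in> underS \<Lambda> z" "a \<in> Field \<kappa>" "rk (?B a) y v"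
      using rk.IH[OF v] v by blast
    have "le_on (?B a) (V a) v"
      unfolding le_on_def using ev_Field
      by eventually_elim (use ya(2) V(1) in \<open>auto simp: v_def Prd_def intro: wo_refl wo_L\<close>)
    then have "rk (?B a) y (V a)"
      using rk_mono[OF ya(3), of "V a" "?B a"] by simp
    then show False
      using V(3) ya by blast
  qed
qed

section \<open>Existence of ranks\<close>

definition lt_rel :: "'k set \<Rightarrow> ('k \<Rightarrow> 'a set) rel" where
  "lt_rel A = {(v, u). v \<in> Prd \<and> lt_on A v u}"

text \<open>By countable completeness an infinite descent modulo \<open>D\<close> would be a descent
  in \<open>L i\<close> at almost every \<open>i\<close> in \<open>A\<close>.\<close>

lemma wf_lt_rel:
  assumes "positive A"
  shows "wf (lt_rel A)"
  unfolding wf_iff_no_infinite_down_chain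
proof (rule notI, erule exE)
  fix f :: "nat \<Rightarrow> 'k \<Rightarrow> 'a set" assume "\<forall>n. (f (Suc n), f n) \<in> lt_rel A"
  then have "\<forall>\<^sub>F i in D. i \<in> A \<longrightarrow> f (Suc n) i \<in> underS (L i) (f n i)" for n
    by (simp add: lt_rel_def lt_on_def)
  then have "\<forall>\<^sub>F i in D. \<forall>n. i \<in> A \<longrightarrow> f (Suc n) i \<in> underS (L i) (f n i)"
    by (rule ev_countable)
  with ev_Field have "\<forall>\<^sub>F i in D. i \<notin> A"
  proof eventually_elim
    case (elim i)
    have "wf (L i - Id)"
      using wo_L[OF elim(1)] by (simp add: order_on_defs)
    then show ?case
      using elim(2) unfolding wf_iff_no_infinite_down_chain by (auto simp: underS_def)
  qed
  then show False
    using assms by (simp add: frequently_def)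
qed

text \<open>By well-founded induction the predecessors of \<open>u\<close> have ranks below
  \<Lambda>. Counting pieces shows that at most \<mu> different ranks occur, so they are bounded in
  \<Lambda>.\<close>

lemma rk_exists:
  assumes A: "positive A" and "u \<in> Prd"
  shows "\<exists>z. rk A z u"
  using wf_lt_rel[OF A] assms(2)
proof (induction u rule: wf_induct_rule)
  case (less u)
  define S where "S = {v \<in> Prd. lt_on A v u}"
  have S: "\<exists>z. rk A z v" if "v \<in> S" for v
    using less that by (simp add: S_def lt_rel_def)
  have "\<exists>z. rk A z v \<and> (\<forall>y. rk A y v \<longrightarrow> (z, y) \<in> \<Lambda>)" if v: "v \<in> S" for v
  proof -
    obtain z where z: "rk A z v"
      using S[OF v] by blast
    show ?thesis
      using wo_least[OF wo_\<Lambda> rk_Field[OF z], of "\<lambda>z. rk A z v", OF z] rk_Field by metis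
  qed
  then have "\<forall>v. \<exists>z. v \<in> S \<longrightarrow> rk A z v \<and> (\<forall>y. rk A y v \<longrightarrow> (z, y) \<in> \<Lambda>)"
    by simp
  from choice[OF this] obtain \<rho> where \<rho>: "\<And>v. v \<in> S \<Longrightarrow> rk A (\<rho> v) v"
    "\<And>v y. v \<in> S \<Longrightarrow> rk A y v \<Longrightarrow> (\<rho> v, y) \<in> \<Lambda>"
    by auto
  \<comment> \<open>Shrinking \<open>A\<close> to the indices where \<open>press\<close> is
    regressive on \<open>v\<close> changes it only by a null set.\<close>
  define A' where "A' v = {i \<in> A. i \<in> limits \<and> v i \<in> underS (L i) (u i)}" for v
  have ex: "\<exists>B a. a \<in> Field \<kappa> \<and> B \<subseteq> A \<and> (B, v) \<in> pieces u a \<and> rk B (\<rho> v) v" if v: "v \<in> S" for v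
  proof -
    have vP: "v \<in> Prd" and "lt_on A v u"
      using v by (auto simp: S_def)
    then have "\<forall>\<^sub>F i in D. i \<in> A \<longrightarrow> i \<in> A' v"
      unfolding lt_on_def using ev_limits by (auto simp: A'_def elim: eventually_elim2)
    then have r: "rk (A' v) (\<rho> v) v"
      using rk_mono[OF \<rho>(1)[OF v] le_on_refl[OF vP]] by blast
    have "\<forall>\<^sub>F i in D. i \<in> A' v \<longrightarrow> press u i (v i) \<in> underS \<kappa> i"
      using press(1)[OF less.prems] by (simp add: A'_def)
    from rk_split[OF r vP this] obtain a where a: "a \<in> Field \<kappa>" "rk {i \<in> A' v. press u i (v i) = a} (\<rho> v) v"
      by blast
    moreover have "({i \<in> A' v. press u i (v i) = a}, v) \<in> pieces u a"
      using press(1)[OF less.prems] by (auto simp: pieces_def A'_def)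
    ultimately show ?thesis
      by (intro exI[of _ "{i \<in> A' v. press u i (v i) = a}"] exI[of _ a]) (auto simp: A'_def)
  qed
  then have "\<forall>v. \<exists>B. v \<in> S \<longrightarrow> (\<exists>a. a \<in> Field \<kappa> \<and> B \<subseteq> A \<and> (B, v) \<in> pieces u a \<and> rk B (\<rho> v) v)"
    by blast
  from choice[OF this] obtain B
    where ex_B: "\<forall>v. v \<in> S \<longrightarrow> (\<exists>a. a \<in> Field \<kappa> \<and> B v \<subseteq> A \<and> (B v, v) \<in> pieces u a \<and> rk (B v) (\<rho> v) v)" ..
  have B: "B v \<subseteq> A" "rk (B v) (\<rho> v) v" "\<exists>a\<in>Field \<kappa>. (B v, v) \<in> pieces u a" if "v \<in> S" for v
    using ex_B[rule_format, OF that] by auto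
  \<comment> \<open>\<open>B w\<close> lies in \<open>A\<close>, so a function agreeing with
    \<open>w\<close> on \<open>B w\<close> has rank at most \<open>\<rho> w\<close> for
    \<open>A\<close>; by symmetry the piece determines the rank.\<close>
  have same: "\<rho> v = \<rho> w" if vw: "v \<in> S" "w \<in> S" "B v = B w" "\<And>i. i \<in> B v \<Longrightarrow> v i = w i" for v w
  proof -
    have "(\<rho> v, \<rho> w) \<in> \<Lambda>" if vw: "v \<in> S" "w \<in> S" "B v = B w" "\<And>i. i \<in> B v \<Longrightarrow> v i = w i" for v w
    proof -
      have "le_on (B w) v w"
        unfolding le_on_def using ev_Field
        by eventually_elim (use vw in \<open>auto simp: S_def Prd_def intro: wo_refl wo_L\<close>)
      then have "rk A (\<rho> w) v"
        using rk_mono[OF B(2)[OF vw(2)]] B(1)[OF vw(2)] by (simp add: subset_iff)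
      then show ?thesis
        using \<rho>(2)[OF vw(1)] by blast
    qed
    from this[of v w] this[of w v] show ?thesis
      using vw wo_antisym[OF wo_\<Lambda>] by metis
  qed
  \<comment> \<open>One representative per rank: then a piece also determines the representative, as
    counting pieces requires.\<close>
  define r where "r = inv_into S \<rho>"
  have r: "r z \<in> S" "\<rho> (r z) = z" if "z \<in> \<rho> ` S" for z
    using that by (auto simp: r_def inv_into_into f_inv_into_f)
  let ?V = "(\<lambda>z. (B (r z), r z)) ` \<rho> ` S"
  have "|?V| \<le>o \<mu>"
  proof (rule card_pieces[OF less.prems])
    show "?V \<subseteq> (\<Union>a\<in>Field \<kappa>. pieces u a)"
      using r B(3) by blast
    fix C v w assume "(C, v) \<in> ?V" "(C, w) \<in> ?V" and eq: "\<And>i. i \<in> C \<Longrightarrow> v i = w i"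
    then obtain y z where yz: "y \<in> \<rho> ` S" "z \<in> \<rho> ` S" "C = B (r y)" "C = B (r z)" "v = r y" "w = r z"
      by blast
    then have "\<rho> (r y) = \<rho> (r z)"
      using same[OF r(1)[OF yz(1)] r(1)[OF yz(2)]] eq by simp
    then show "v = w"
      using r(2) yz by metis
  qed
  moreover have "inj_on (\<lambda>z. (B (r z), r z)) (\<rho> ` S)"
    by (rule inj_onI) (use r(2) in \<open>metis prod.inject\<close>)
  then have "|\<rho> ` S| \<le>o |?V|"
    by (intro card_of_ordLeqI) auto
  ultimately have "|\<rho> ` S| \<le>o \<mu>"
    using ordLeq_transitive by blast
  moreover have "\<rho> ` S \<subseteq> Field \<Lambda>"
    using \<rho>(1) rk_Field by blast
  ultimately obtain b where b: "b \<in> Field \<Lambda>" "\<And>z. z \<in> \<rho> ` S \<Longrightarrow> z \<in> underS \<Lambda> b"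
    using \<Lambda>_bounded by blast
  have "rk A b u"
    using b \<rho>(1) by (intro rk) (auto simp: S_def)
  then show ?case
    by blast
qed

section \<open>The Galvin-Hajnal rank as a function into \<Lambda>\<close>

definition \<Phi> :: "('k \<Rightarrow> 'a set) \<Rightarrow> 'm set" where
  "\<Phi> u = (SOME z. rk UNIV z u \<and> (\<forall>y. rk UNIV y u \<longrightarrow> (z, y) \<in> \<Lambda>))"

lemma \<Phi>:
  assumes "u \<in> Prd"
  shows "rk UNIV (\<Phi> u) u" and "\<And>y. rk UNIV y u \<Longrightarrow> (\<Phi> u, y) \<in> \<Lambda>"
proof -
  let ?P = "\<lambda>z. rk UNIV z u \<and> (\<forall>y. rk UNIV y u \<longrightarrow> (z, y) \<in> \<Lambda>)"
  obtain z where z: "rk UNIV z u"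
    using rk_exists[OF positive_UNIV assms] by blast
  obtain y where "?P y"
    using wo_least[OF wo_\<Lambda> rk_Field[OF z], of "\<lambda>z. rk UNIV z u", OF z] rk_Field by metis
  then have "?P (\<Phi> u)"
    unfolding \<Phi>_def by (rule someI[of ?P])
  then show "rk UNIV (\<Phi> u) u" and "\<And>y. rk UNIV y u \<Longrightarrow> (\<Phi> u, y) \<in> \<Lambda>"
    by blast+
qed

lemma \<Phi>_Field: "u \<in> Prd \<Longrightarrow> \<Phi> u \<in> Field \<Lambda>"
  using \<Phi>(1) rk_Field by blast

lemma \<Phi>_strict:
  assumes "u \<in> Prd" "v \<in> Prd" "lt_on UNIV u v"
  shows "\<Phi> u \<in> underS \<Lambda> (\<Phi> v)"
  using rkD[OF \<Phi>(1)[OF assms(2)] assms(1,3)] \<Phi>(2)[OF assms(1)] wo_le_less_trans[OF wo_\<Lambda>] by blast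

lemma \<Phi>_mono:
  assumes "u \<in> Prd" "v \<in> Prd" "le_on UNIV u v"
  shows "(\<Phi> u, \<Phi> v) \<in> \<Lambda>"
  using rk_mono[OF \<Phi>(1)[OF assms(2)] assms(3)] \<Phi>(2)[OF assms(1)] by simp

text \<open>If all predecessors of \<open>u\<close> had rank below \<open>y\<close>, the rank of
  \<open>u\<close> would be at most \<open>y\<close>.\<close>

lemma \<Phi>_below:
  assumes "u \<in> Prd" and "y \<in> underS \<Lambda> (\<Phi> u)"
  shows "\<exists>w\<in>Prd. lt_on UNIV w u \<and> (y, \<Phi> w) \<in> \<Lambda>"
proof (rule ccontr)
  assume no: "\<not> ?thesis"
  have y: "y \<in> Field \<Lambda>"
    using assms(2) by (rule less_Field1)
  have "rk UNIV y u"
  proof (rule rk[OF y])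
    fix v assume v: "v \<in> Prd" "lt_on UNIV v u"
    then have "\<Phi> v \<in> underS \<Lambda> y"
      using no wo_le_or_less[OF wo_\<Lambda> y \<Phi>_Field[OF v(1)]] by blast
    then show "\<exists>z\<in>underS \<Lambda> y. rk UNIV z v"
      using \<Phi>(1)[OF v(1)] by blast
  qed
  then show False
    using \<Phi>(2)[OF assms(1)] wo_less_not_le[OF wo_\<Lambda> assms(2)] by blast
qed

text \<open>If \<open>u\<close> is not above \<open>x\<close>, its rank is at most that of \<open>x\<close> for one of the \<open>2\<^sup>\<kappa>\<close> relations \<^term>\<open>lt_on B\<close>.\<close>

lemma \<Phi>_large:
  assumes x: "x \<in> Prd"
  shows "\<exists>z\<in>Field \<Lambda>. \<forall>u\<in>Prd. (z, \<Phi> u) \<in> \<Lambda> \<longrightarrow> lt_on UNIV x u"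
proof -
  have "\<forall>B. \<exists>z. positive B \<longrightarrow> rk B z x"
    using rk_exists[OF _ x] by blast
  from choice[OF this] obtain f where f: "\<And>B. positive B \<Longrightarrow> rk B (f B) x"
    by blast
  let ?S = "{B \<in> Pow (Field \<kappa>). positive B}"
  have "|f ` ?S| \<le>o |?S|"
    by (rule card_of_image)
  also have "|?S| \<le>o |Pow (Field \<kappa>)|"
    by (rule card_of_mono1) blast
  also have "|Pow (Field \<kappa>)| \<le>o \<mu>"
    by (rule Pow_le_\<mu>)
  finally have "|f ` ?S| \<le>o \<mu>" .
  moreover have "f ` ?S \<subseteq> Field \<Lambda>"
    using f rk_Field by blast
  ultimately obtain z where z: "z \<in> Field \<Lambda>" "\<And>y. y \<in> f ` ?S \<Longrightarrow> y \<in> underS \<Lambda> z"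
    using \<Lambda>_bounded by blast
  have "lt_on UNIV x u" if u: "u \<in> Prd" "(z, \<Phi> u) \<in> \<Lambda>" for u
  proof (rule ccontr)
    assume no: "\<not> lt_on UNIV x u"
    \<comment> \<open>On this set \<open>u\<close> is at most \<open>x\<close>, so the rank of
      \<open>u\<close> would be at most \<open>f ?B\<close>, which is below
      \<open>z\<close>.\<close>
    let ?B = "{i \<in> Field \<kappa>. x i \<notin> underS (L i) (u i)}"
    have B: "positive ?B"
    proof (rule ccontr)
      assume "\<not> positive ?B"
      then have "\<forall>\<^sub>F i in D. i \<notin> ?B"
        by (simp add: not_frequently)
      then have "lt_on UNIV x u"
        unfolding lt_on_def using ev_Field by eventually_elim blast
      then show False
        using no by blast
    qed
    have "(u i, x i) \<in> L i" if "i \<in> ?B" for i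
      using that wo_le_or_less[OF wo_L, of i "u i" "x i"] x u(1) by (auto simp: Prd_def)
    then have "le_on ?B u x"
      by (auto simp: le_on_def intro: always_eventually)
    then have "rk UNIV (f ?B) u"
      using rk_mono[OF f[OF B]] by simp
    then have "(\<Phi> u, f ?B) \<in> \<Lambda>"
      by (rule \<Phi>(2)[OF u(1)])
    moreover have "f ?B \<in> underS \<Lambda> z"
      by (rule z(2)) (use B in simp)
    then have "f ?B \<in> underS \<Lambda> (\<Phi> u)"
      using u(2) by (rule wo_less_le_trans[OF wo_\<Lambda>])
    then have "(\<Phi> u, f ?B) \<notin> \<Lambda>"
      by (rule wo_less_not_le[OF wo_\<Lambda>])
    ultimately show False
      by contradiction
  qed
  then show ?thesis
    using z(1) by blast
qed

text \<open>Inductively, take a common bound \<open>u\<close> of functions \<open>f y\<close> with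
  rank at least \<open>y\<close>, for all \<open>y\<close> below \<open>z\<close>. If the rank of
  \<open>u\<close> were some \<open>y\<close> below \<open>z\<close>, then \<open>f y\<close>, being
  below \<open>u\<close>, would have rank less than \<open>y\<close>.\<close>

lemma \<Phi>_unbounded:
  assumes "z \<in> Field \<Lambda>"
  shows "\<exists>u\<in>Prd. (z, \<Phi> u) \<in> \<Lambda>"
  using wo_\<Lambda> assms
proof (induction rule: wo_induct)
  case (less z)
  then have "\<forall>y. \<exists>u. y \<in> underS \<Lambda> z \<longrightarrow> u \<in> Prd \<and> (y, \<Phi> u) \<in> \<Lambda>"
    by blast
  from choice[OF this] obtain f where f: "\<And>y. y \<in> underS \<Lambda> z \<Longrightarrow> f y \<in> Prd \<and> (y, \<Phi> (f y)) \<in> \<Lambda>"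
    by blast
  have "|f ` underS \<Lambda> z| \<le>o \<mu>"
    using ordLeq_transitive[OF card_of_image cardSuc_underS[OF card_\<mu> less.hyps]] .
  moreover have "f ` underS \<Lambda> z \<subseteq> Prd"
    using f by blast
  ultimately obtain u where u: "u \<in> Prd" "\<And>w. w \<in> f ` underS \<Lambda> z \<Longrightarrow> lt_on UNIV w u"
    using common_bound by blast
  have "(z, \<Phi> u) \<in> \<Lambda>"
  proof (rule ccontr)
    assume "(z, \<Phi> u) \<notin> \<Lambda>"
    then have *: "\<Phi> u \<in> underS \<Lambda> z"
      using wo_le_or_less[OF wo_\<Lambda> less.hyps \<Phi>_Field[OF u(1)]] by blast
    then have "\<Phi> (f (\<Phi> u)) \<in> underS \<Lambda> (\<Phi> u)"
      using \<Phi>_strict[OF _ u(1) u(2)] f by blast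
    then show False
      using f[OF *] wo_less_not_le[OF wo_\<Lambda>] by blast
  qed
  then show ?case
    using u(1) by blast
qed

end


subsection \<open>Accumulation points and sequences of functions\<close>

lemma acc_pts_mono: "A \<subseteq> B \<Longrightarrow> acc_pts r A \<subseteq> acc_pts r B"
  unfolding acc_pts_def by blast

text \<open>Closing a set off adds no accumulation points, so the closure of an unbounded set is a
  club.\<close>

lemma acc_pts_Un_acc_pts:
  assumes "Well_order r"
  shows "acc_pts r (A \<union> acc_pts r A) = acc_pts r A"
proof
  show "acc_pts r (A \<union> acc_pts r A) \<subseteq> acc_pts r A"
  proof
    fix d assume d: "d \<in> acc_pts r (A \<union> acc_pts r A)"
    have "\<exists>c\<in>A \<inter> underS r d. a \<in> underS r c" if a: "a \<in> underS r d" for a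
    proof -
      obtain c where c: "c \<in> A \<union> acc_pts r A" "c \<in> underS r d" "a \<in> underS r c"
        using d a unfolding acc_pts_def by blast
      show ?thesis
      proof (cases "c \<in> A")
        case True
        then show ?thesis
          using c by blast
      next
        case False
        then have "c \<in> acc_pts r A"
          using c(1) by blast
        then obtain b where b: "b \<in> A" "b \<in> underS r c" "a \<in> underS r b"
          using c(3) unfolding acc_pts_def by blast
        show ?thesis
          using b wo_less_trans[OF assms b(2) c(2)] by blast
      qed
    qed
    then show "d \<in> acc_pts r A"
      using d unfolding acc_pts_def by blast
  qed
qed (rule acc_pts_mono, blast)

lemma acc_pts_tail:
  assumes "Well_order r" and "d \<in> acc_pts r A" and z: "z \<in> underS r d"
  shows "d \<in> acc_pts r {y \<in> A. z \<in> underS r y}"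
proof -
  have "\<exists>c\<in>{y \<in> A. z \<in> underS r y} \<inter> underS r d. a \<in> underS r c" if a: "a \<in> underS r d" for a
  proof (cases "(a, z) \<in> r")
    case True
    obtain c where c: "c \<in> A" "c \<in> underS r d" "z \<in> underS r c"
      using assms(2) z unfolding acc_pts_def by blast
    then show ?thesis
      using wo_le_less_trans[OF assms(1) True c(3)] by blast
  next
    case False
    then have za: "z \<in> underS r a"
      using wo_le_or_less[OF assms(1) less_Field1[OF a] less_Field1[OF z]] by blast
    obtain c where c: "c \<in> A" "c \<in> underS r d" "a \<in> underS r c"
      using assms(2) a unfolding acc_pts_def by blast
    then show ?thesis
      using wo_less_trans[OF assms(1) za c(3)] by blast
  qed
  then show ?thesis
    using assms(2) unfolding acc_pts_def by blast
qed

lemma wo_successor: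
  assumes r: "Well_order r" and ab: "a \<in> underS r b"
  obtains c where "c \<in> Field r" "underS r c = under r a" "(c, b) \<in> r" "a \<in> underS r c"
proof -
  obtain c where c: "c \<in> Field r" "a \<in> underS r c" "\<And>d. d \<in> underS r c \<Longrightarrow> a \<notin> underS r d"
    "\<And>d. d \<in> Field r \<Longrightarrow> a \<in> underS r d \<Longrightarrow> (c, d) \<in> r"
    using wo_least[OF r less_Field2[OF ab], of "\<lambda>c. a \<in> underS r c", OF ab] by blast
  have "underS r c = under r a"
  proof
    show "underS r c \<subseteq> under r a"
    proof
      fix d assume d: "d \<in> underS r c"
      then show "d \<in> under r a"
        using wo_le_or_less[OF r less_Field1[OF d] less_Field1[OF ab]] c(3)[OF d] by (simp add: under_def)
    qed
    show "under r a \<subseteq> underS r c"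
      using wo_le_less_trans[OF r _ c(2)] by (auto simp: under_def)
  qed
  then show thesis
    using that c(1,2) c(4)[OF less_Field2[OF ab] ab] by blast
qed

text \<open>The immediate successor \<open>l\<close> of \<open>j\<close> extends the successor
  condition to all pairs: \<open>C k\<close> is almost contained in \<open>C l\<close>, which is
  contained in the accumulation points of \<open>C j\<close>.\<close>

lemma club_seq_almost_acc:
  assumes s: "Cinfinite s" and t: "Well_order t"
    and C: "incr_seq t {C. club (cardSuc s) C} (\<lambda>A B. |B - A| <o cardSuc s) C" "acc_seq (cardSuc s) t C"
    and jk: "j \<in> underS t k"
  shows "\<exists>x\<in>Field (cardSuc s). \<forall>y\<in>C k. x \<in> underS (cardSuc s) y \<longrightarrow> y \<in> acc_pts (cardSuc s) (C j)"
proof -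
  have wo: "Well_order (cardSuc s)"
    using s by (simp add: cardSuc_Well_order)
  obtain l where l: "l \<in> Field t" "underS t l = under t j" "(l, k) \<in> t" "j \<in> underS t l"
    using wo_successor[OF t jk] by blast
  have acc: "C l \<subseteq> acc_pts (cardSuc s) (C j)"
    using C(2) l(1,2) less_Field1[OF jk] by (simp add: acc_seq_def)
  have "\<not> cofinal (C k - C l) (cardSuc s)"
  proof (cases "l = k")
    case True
    have "Field (cardSuc s) \<noteq> {}"
      using Cinfinite_cardSuc[OF s] by (auto simp: cinfinite_def)
    then show ?thesis
      using True by (auto simp: cofinal_def)
  next
    case False
    then have "l \<in> underS t k"
      using l(3) by (simp add: underS_def)
    then have "|C k - C l| <o cardSuc s" and "club (cardSuc s) (C k)"
      using C(1) less_Field2[OF jk] by (auto simp: incr_seq_def)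
    moreover from this(2) have "C k - C l \<subseteq> Field (cardSuc s)"
      by (auto simp: club_def)
    ultimately show ?thesis
      using card_less_cofinal[OF s] by blast
  qed
  then obtain x where x: "x \<in> Field (cardSuc s)" "\<And>y. y \<in> C k - C l \<Longrightarrow> x \<notin> underS (cardSuc s) y"
    unfolding cofinal_underS by blast
  then show ?thesis
    using acc by blast
qed

text \<open>The sequence \<open>g\<close> of length \<open>t\<close> in the product of the
  \<open>\<theta> i\<close> is the one supplied by the hypothesis on the depth.\<close>

locale depth_scale = card_scale \<kappa> m \<mu> D
  for \<kappa> :: "'k rel" and m :: "'k \<Rightarrow> 'a rel" and \<mu> :: "'m rel" and D :: "'k filter" +
  fixes \<theta> :: "'k \<Rightarrow> 't rel" and t :: "'s rel" and g :: "'s \<Rightarrow> 'k \<Rightarrow> 't"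
  assumes wo_\<theta>: "\<And>i. i \<in> Field \<kappa> \<Longrightarrow> Well_order (\<theta> i)" and wo_t: "Well_order t"
    and g: "incr_seq t (\<Pi> i\<in>Field \<kappa>. Field (\<theta> i)) (\<lambda>f g. \<forall>\<^sub>F i in D. f i \<in> underS (\<theta> i) (g i)) g"
begin

lemma g_Field: "a \<in> Field t \<Longrightarrow> i \<in> Field \<kappa> \<Longrightarrow> g a i \<in> Field (\<theta> i)"
  using g unfolding incr_seq_def by blast

lemma g_less: "a \<in> underS t b \<Longrightarrow> \<forall>\<^sub>F i in D. g a i \<in> underS (\<theta> i) (g b i)"
  using g less_Field2[of a t b] by (simp add: incr_seq_def)

text \<open>At the exceptional indices an arbitrary element of \<open>L i\<close> is taken, so that
  \<open>x\<close> lies in the product.\<close>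

lemma ae_choice:
  assumes "\<forall>\<^sub>F i in D. \<exists>x\<in>Field (L i). P i x"
  obtains x where "x \<in> Prd" "\<forall>\<^sub>F i in D. P i (x i)"
proof -
  have "\<exists>x. i \<in> Field \<kappa> \<longrightarrow> x \<in> Field (L i) \<and> ((\<exists>x\<in>Field (L i). P i x) \<longrightarrow> P i x)" for i
  proof (cases "i \<in> Field \<kappa>")
    case True
    then have "Field (L i) \<noteq> {}"
      using Cinfinite_cardSuc[OF inf_m[OF True]] by (auto simp: cinfinite_def)
    then show ?thesis
      by blast
  qed blast
  then have "\<forall>i. \<exists>x. i \<in> Field \<kappa> \<longrightarrow> x \<in> Field (L i) \<and> ((\<exists>x\<in>Field (L i). P i x) \<longrightarrow> P i x)" ..
  from choice[OF this] obtain x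
    where x: "\<forall>i. i \<in> Field \<kappa> \<longrightarrow> x i \<in> Field (L i) \<and> ((\<exists>x\<in>Field (L i). P i x) \<longrightarrow> P i (x i))" ..
  show thesis
  proof
    show "x \<in> Prd"
      using x by (simp add: Prd_def)
    show "\<forall>\<^sub>F i in D. P i (x i)"
      using assms ev_Field by eventually_elim (use x in blast)
  qed
qed

text \<open>This substitutes for a scale: it is not chosen to be increasing, but every function of
  the product is below \<open>scale z\<close> for all large \<open>z\<close>.\<close>

definition scale :: "'m set \<Rightarrow> 'k \<Rightarrow> 'a set" where
  "scale z = (SOME u. u \<in> Prd \<and> (z, \<Phi> u) \<in> \<Lambda>)"

lemma scale: "z \<in> Field \<Lambda> \<Longrightarrow> scale z \<in> Prd" "z \<in> Field \<Lambda> \<Longrightarrow> (z, \<Phi> (scale z)) \<in> \<Lambda>"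
  unfolding atomize_imp[symmetric]
  using someI_ex[of "\<lambda>u. u \<in> Prd \<and> (z, \<Phi> u) \<in> \<Lambda>"] \<Phi>_unbounded[of z] unfolding scale_def by blast+

lemma scale_large:
  assumes "x \<in> Prd"
  obtains z where "z \<in> Field \<Lambda>" "\<And>y. (z, y) \<in> \<Lambda> \<Longrightarrow> lt_on UNIV x (scale y)"
proof -
  obtain z where z: "z \<in> Field \<Lambda>" "\<forall>u\<in>Prd. (z, \<Phi> u) \<in> \<Lambda> \<longrightarrow> lt_on UNIV x u"
    using \<Phi>_large[OF assms] ..
  show thesis
  proof (rule that[OF z(1)])
    fix y assume y: "(z, y) \<in> \<Lambda>"
    then have "y \<in> Field \<Lambda>"
      using le_Field by fast
    then show "lt_on UNIV x (scale y)"
      using z(2) scale wo_le_trans[OF wo_\<Lambda> y] by blast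
  qed
qed

text \<open>For \<open>a\<close> before \<open>b\<close>, almost every coordinate has a bound
  \<open>x i\<close> beyond which the two functions are strictly ordered. All large \<open>z\<close>
  have \<open>scale z\<close> above \<open>x\<close>, and strictness of \<Phi> carries the
  comparison to \<Lambda>.\<close>

lemma has_seq_Functions:
  assumes "\<And>i. i \<in> Field \<kappa> \<Longrightarrow> has_seq Functions (L i) (\<theta> i)"
  shows "has_seq Functions \<Lambda> t"
proof -
  have "\<forall>i. \<exists>F. i \<in> Field \<kappa> \<longrightarrow> incr_seq (\<theta> i) (Field (L i) \<rightarrow> Field (L i)) (less_bd (L i)) F"
    using assms by simp
  from choice[OF this] obtain F
    where F: "\<forall>i. i \<in> Field \<kappa> \<longrightarrow> incr_seq (\<theta> i) (Field (L i) \<rightarrow> Field (L i)) (less_bd (L i)) (F i)" ..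
  define G where "G a z = (\<lambda>i. F i (g a i) (scale z i))" for a z
  have G: "G a z \<in> Prd" if "a \<in> Field t" "z \<in> Field \<Lambda>" for a z
  proof -
    have "F i (g a i) (scale z i) \<in> Field (L i)" if i: "i \<in> Field \<kappa>" for i
    proof -
      have "F i (g a i) \<in> Field (L i) \<rightarrow> Field (L i)"
        using F i g_Field[OF \<open>a \<in> Field t\<close> i] by (simp add: incr_seq_def)
      moreover have "scale z i \<in> Field (L i)"
        using scale(1)[OF \<open>z \<in> Field \<Lambda>\<close>] i by (simp add: Prd_def)
      ultimately show ?thesis
        by blast
    qed
    then show ?thesis
      by (simp add: G_def Prd_def)
  qed
  have "less_bd \<Lambda> (\<lambda>z. \<Phi> (G a z)) (\<lambda>z. \<Phi> (G b z))" if ab: "a \<in> underS t b" for a b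
  proof -
    have "\<forall>\<^sub>F i in D. \<exists>x\<in>Field (L i). \<forall>y\<in>Field (L i). x \<in> underS (L i) y \<longrightarrow>
        F i (g a i) y \<in> underS (L i) (F i (g b i) y)"
      using g_less[OF ab] ev_Field
    proof eventually_elim
      case (elim i)
      have Fi: "F i j \<in> Field (L i) \<rightarrow> Field (L i)" if "j \<in> Field (\<theta> i)" for j
        using F elim(2) that by (simp add: incr_seq_def)
      have "less_bd (L i) (F i (g a i)) (F i (g b i))"
        using F elim less_Field2[OF elim(1)] by (simp add: incr_seq_def)
      then obtain x where x: "x \<in> Field (L i)"
        "\<And>y. y \<in> Field (L i) \<Longrightarrow> (F i (g b i) y, F i (g a i) y) \<in> L i \<Longrightarrow> x \<notin> underS (L i) y"
        unfolding less_bd_def cofinal_underS by blast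
      have "F i (g a i) y \<in> underS (L i) (F i (g b i) y)" if y: "y \<in> Field (L i)" "x \<in> underS (L i) y" for y
      proof -
        have "F i (g a i) y \<in> Field (L i)" "F i (g b i) y \<in> Field (L i)"
          using Fi[OF less_Field1[OF elim(1)]] Fi[OF less_Field2[OF elim(1)]] y(1) by auto
        then show ?thesis
          using x(2)[OF y(1)] y(2) wo_le_or_less[OF wo_L[OF elim(2)]] by blast
      qed
      then show ?case
        using x(1) by blast
    qed
    then obtain x where x: "x \<in> Prd" "\<forall>\<^sub>F i in D. \<forall>y\<in>Field (L i). x i \<in> underS (L i) y \<longrightarrow>
        F i (g a i) y \<in> underS (L i) (F i (g b i) y)"
      by (rule ae_choice)
    obtain z where z: "z \<in> Field \<Lambda>" "\<And>y. (z, y) \<in> \<Lambda> \<Longrightarrow> lt_on UNIV x (scale y)"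
      using scale_large[OF x(1)] by blast
    have "(\<Phi> (G b y), \<Phi> (G a y)) \<notin> \<Lambda>" if y: "(z, y) \<in> \<Lambda>" for y
    proof -
      have yF: "y \<in> Field \<Lambda>"
        using le_Field[OF y] by simp
      have "lt_on UNIV (G a y) (G b y)"
        unfolding lt_on_def G_def using z(2)[OF y, unfolded lt_on_def] x(2) ev_Field
      proof eventually_elim
        case (elim i)
        have "scale y i \<in> Field (L i)"
          using scale(1)[OF yF] elim(3) by (simp add: Prd_def)
        then show ?case
          using elim by blast
      qed
      then have "\<Phi> (G a y) \<in> underS \<Lambda> (\<Phi> (G b y))"
        by (rule \<Phi>_strict[OF G[OF less_Field1[OF ab] yF] G[OF less_Field2[OF ab] yF]])
      then show ?thesis
        by (rule wo_less_not_le[OF wo_\<Lambda>])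
    qed
    then show ?thesis
      using z(1) unfolding less_bd_def cofinal_def by blast
  qed
  moreover have "(\<lambda>z. \<Phi> (G a z)) \<in> Field \<Lambda> \<rightarrow> Field \<Lambda>" if "a \<in> Field t" for a
    using \<Phi>_Field[OF G[OF that]] by blast
  ultimately have "incr_seq t (Field \<Lambda> \<rightarrow> Field \<Lambda>) (less_bd \<Lambda>) (\<lambda>a z. \<Phi> (G a z))"
    unfolding incr_seq_def by blast
  then show ?thesis
    by auto
qed

end


subsection \<open>Sequences of clubs\<close>

definition succ_rel :: "'x rel \<Rightarrow> 'x rel" where
  "succ_rel t = {(a, b). a \<in> Field t \<and> b \<in> Field t \<and> underS t b = under t a}"

lemma succ_rel_less:
  assumes "Well_order t" and "(a, b) \<in> succ_rel t"
  shows "a \<in> underS t b"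
  using assms wo_refl[OF assms(1), of a] by (auto simp: succ_rel_def under_def)

lemma succ_rel_unique:
  assumes t: "Well_order t"
  shows "(a, b) \<in> succ_rel t \<Longrightarrow> (a, c) \<in> succ_rel t \<Longrightarrow> b = c"
    and "(a, c) \<in> succ_rel t \<Longrightarrow> (b, c) \<in> succ_rel t \<Longrightarrow> a = b"
proof -
  assume "(a, b) \<in> succ_rel t" "(a, c) \<in> succ_rel t"
  then have bc: "underS t b = underS t c" "b \<in> Field t" "c \<in> Field t"
    by (auto simp: succ_rel_def)
  have "c \<notin> underS t b" "b \<notin> underS t c"
    by (simp_all add: underS_notIn bc(1)) (simp add: underS_notIn bc(1)[symmetric])
  then have "(b, c) \<in> t" "(c, b) \<in> t"
    using wo_le_or_less[OF t bc(2,3)] wo_le_or_less[OF t bc(3,2)] by blast+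
  then show "b = c"
    by (rule wo_antisym[OF t])
next
  assume "(a, c) \<in> succ_rel t" "(b, c) \<in> succ_rel t"
  then have ab: "under t a = under t b" "a \<in> Field t" "b \<in> Field t"
    by (auto simp: succ_rel_def)
  have "a \<in> under t b" "b \<in> under t a"
    using wo_refl[OF t ab(2)] wo_refl[OF t ab(3)] ab(1) by (auto simp: under_def)
  then have "(a, b) \<in> t" "(b, a) \<in> t"
    by (simp_all add: under_def)
  then show "a = b"
    by (rule wo_antisym[OF t])
qed

text \<open>The points at finite distance from \<open>a\<close>: an equivalence class containing
  with each point its immediate successor and predecessor, if any.\<close>

definition succ_class :: "'x rel \<Rightarrow> 'x \<Rightarrow> 'x set" where
  "succ_class t a = (succ_rel t \<union> (succ_rel t)\<inverse>)\<^sup>* `` {a}"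

lemma succ_class_eq:
  assumes "(a, b) \<in> succ_rel t"
  shows "succ_class t a = succ_class t b"
proof -
  let ?R = "succ_rel t \<union> (succ_rel t)\<inverse>"
  have "(a, b) \<in> ?R\<^sup>*" "(b, a) \<in> ?R\<^sup>*"
    using assms by auto
  then show ?thesis
    unfolding succ_class_def by (blast intro: rtrancl_trans)
qed

lemma succ_class_self: "a \<in> succ_class t a"
  by (simp add: succ_class_def)

text \<open>A point has at most one immediate successor and one immediate predecessor, so finitely
  many points are reachable in \<open>n\<close> steps and the class is countable.\<close>

lemma card_succ_class:
  assumes t: "Well_order t" and s: "Cinfinite s"
  shows "|succ_class t a| \<le>o s"
proof -
  let ?R = "succ_rel t \<union> (succ_rel t)\<inverse>"
  have R: "finite (?R `` {x})" for x
  proof -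
    have *: "finite X" if "\<And>y z. y \<in> X \<Longrightarrow> z \<in> X \<Longrightarrow> y = z" for X :: "'a set"
    proof (cases "X = {}")
      case False
      then obtain y where "y \<in> X"
        by blast
      then have "X \<subseteq> {y}"
        using that by blast
      then show ?thesis
        by (rule finite_subset) simp
    qed simp
    have "finite (succ_rel t `` {x})" "finite ((succ_rel t)\<inverse> `` {x})"
      using succ_rel_unique[OF t] by (auto intro!: *)
    then show ?thesis
      by (simp add: Un_Image)
  qed
  have fin: "finite ((?R ^^ n) `` {a})" for n
  proof (induction n)
    case (Suc n)
    have "(?R ^^ Suc n) `` {a} = (\<Union>x\<in>(?R ^^ n) `` {a}. ?R `` {x})"
      by auto
    then show ?case
      using Suc R by simp
  qed simp
  have "succ_class t a = (\<Union>n. (?R ^^ n) `` {a})"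
    by (auto simp: succ_class_def rtrancl_power)
  moreover have "|\<Union>n. (?R ^^ n) `` {a}| \<le>o s"
  proof (rule UNION_Cinfinite_bound)
    show "|UNIV :: nat set| \<le>o s"
      using ordIso_ordLeq_trans[OF card_of_nat natLeq_ordLeq_cinfinite[OF s]] .
    show "\<forall>n\<in>UNIV. |(?R ^^ n) `` {a}| \<le>o s"
    proof
      fix n
      have "|(?R ^^ n) `` {a}| <o natLeq"
        using fin finite_iff_ordLess_natLeq by blast
      then show "|(?R ^^ n) `` {a}| \<le>o s"
        using ordLess_imp_ordLeq ordLeq_transitive natLeq_ordLeq_cinfinite[OF s] by blast
    qed
  qed (rule s)
  ultimately show ?thesis
    by simp
qed

text \<open>
  An almost decreasing sequence of clubs \<open>E\<close> with \<open>E b\<close> almost contained in \<open>acc E a\<close> for \<open>a < b\<close>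
  becomes an \<^const>\<open>acc_seq\<close> when the points up to \<open>Z a\<close> are removed from \<open>E a\<close>, where \<open>Z\<close> is
  constant on the countable classes generated by the successor relation.
\<close>

lemma trim_clubs:
  assumes s: "Cinfinite s" and t: "Well_order t"
    and E: "\<And>a. a \<in> Field t \<Longrightarrow> club (cardSuc s) (E a)"
    and acc: "\<And>a b. a \<in> underS t b \<Longrightarrow>
      \<exists>z\<in>Field (cardSuc s). \<forall>y\<in>E b. z \<in> underS (cardSuc s) y \<longrightarrow> y \<in> acc_pts (cardSuc s) (E a)"
  shows "has_seq Clubs (cardSuc s) t"
proof -
  let ?r = "cardSuc s"
  have wo: "Well_order ?r"
    using s by (simp add: cardSuc_Well_order)
  \<comment> \<open>\<open>\<zeta> a\<close> has to serve only the immediate successor of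
    \<open>a\<close>, where the inclusion must be exact; for other pairs a bounded error is
    allowed.\<close>
  have "\<exists>z. a \<in> Field t \<longrightarrow> z \<in> Field ?r \<and>
      (\<forall>b. (a, b) \<in> succ_rel t \<longrightarrow> (\<forall>y\<in>E b. z \<in> underS ?r y \<longrightarrow> y \<in> acc_pts ?r (E a)))" for a
  proof (cases "\<exists>b. (a, b) \<in> succ_rel t")
    case True
    then obtain b where b: "(a, b) \<in> succ_rel t" ..
    obtain z where "z \<in> Field ?r" "\<forall>y\<in>E b. z \<in> underS ?r y \<longrightarrow> y \<in> acc_pts ?r (E a)"
      using acc[OF succ_rel_less[OF t b]] ..
    then show ?thesis
      using succ_rel_unique(1)[OF t b] by (intro exI[of _ z]) simp
  next
    case False
    moreover have "Field ?r \<noteq> {}"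
      using Cinfinite_cardSuc[OF s] by (auto simp: cinfinite_def)
    ultimately show ?thesis
      by blast
  qed
  then have "\<forall>a. \<exists>z. a \<in> Field t \<longrightarrow> z \<in> Field ?r \<and>
      (\<forall>b. (a, b) \<in> succ_rel t \<longrightarrow> (\<forall>y\<in>E b. z \<in> underS ?r y \<longrightarrow> y \<in> acc_pts ?r (E a)))" ..
  from choice[OF this] obtain \<zeta> where \<zeta>: "\<forall>a. a \<in> Field t \<longrightarrow> \<zeta> a \<in> Field ?r \<and>
      (\<forall>b. (a, b) \<in> succ_rel t \<longrightarrow> (\<forall>y\<in>E b. \<zeta> a \<in> underS ?r y \<longrightarrow> y \<in> acc_pts ?r (E a)))" ..
  have ex: "\<exists>z. z \<in> Field ?r \<and> (\<forall>c\<in>succ_class t a \<inter> Field t. \<zeta> c \<in> underS ?r z)" for a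
  proof -
    have "|\<zeta> ` (succ_class t a \<inter> Field t)| \<le>o |succ_class t a \<inter> Field t|"
      by (rule card_of_image)
    also have "|succ_class t a \<inter> Field t| \<le>o |succ_class t a|"
      by (rule card_of_mono1) blast
    also have "|succ_class t a| \<le>o s"
      by (rule card_succ_class[OF t s])
    finally have "|\<zeta> ` (succ_class t a \<inter> Field t)| \<le>o s" .
    moreover have "\<zeta> ` (succ_class t a \<inter> Field t) \<subseteq> Field ?r"
      using \<zeta> by auto
    ultimately obtain z where "z \<in> Field ?r" "\<And>x. x \<in> \<zeta> ` (succ_class t a \<inter> Field t) \<Longrightarrow> x \<in> underS ?r z"
      using cardSuc_bounded[OF s] by blast
    then show ?thesis
      by blast
  qed
  \<comment> \<open>The chosen bound depends on \<open>a\<close> only through its class, so it is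
    literally the same for \<open>a\<close> and its successor.\<close>
  define Z where "Z a = (SOME z. z \<in> Field ?r \<and> (\<forall>c\<in>succ_class t a \<inter> Field t. \<zeta> c \<in> underS ?r z))" for a
  have Z: "Z a \<in> Field ?r" "c \<in> succ_class t a \<Longrightarrow> c \<in> Field t \<Longrightarrow> \<zeta> c \<in> underS ?r (Z a)" for a c
    using someI_ex[OF ex[of a]] unfolding Z_def by auto
  define C where "C a = {y \<in> E a. Z a \<in> underS ?r y}" for a
  have club: "club ?r (C a)" if a: "a \<in> Field t" for a
  proof -
    have "E a \<subseteq> Field ?r" "cofinal (E a) ?r" "acc_pts ?r (E a) \<subseteq> E a"
      using E[OF a] by (auto simp: club_def)
    have "cofinal (C a) ?r"
      unfolding cofinal_underS
    proof
      fix x assume x: "x \<in> Field ?r"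
      have "\<exists>y\<in>Field ?r. (x, y) \<in> ?r \<and> (Z a, y) \<in> ?r"
        using wo_le_or_less[OF wo x Z(1)[of a]] wo_refl[OF wo x] wo_refl[OF wo Z(1)[of a]] x Z(1)[of a]
        by (auto simp: underS_def)
      then obtain y where y: "y \<in> Field ?r" "(x, y) \<in> ?r" "(Z a, y) \<in> ?r"
        by blast
      obtain c where c: "c \<in> E a" "y \<in> underS ?r c"
        using \<open>cofinal (E a) ?r\<close> y(1) unfolding cofinal_underS by blast
      then show "\<exists>c\<in>C a. x \<in> underS ?r c"
        using wo_le_less_trans[OF wo y(2) c(2)] wo_le_less_trans[OF wo y(3) c(2)] by (auto simp: C_def)
    qed
    moreover have "acc_pts ?r (C a) \<subseteq> C a"
    proof
      fix d assume d: "d \<in> acc_pts ?r (C a)"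
      then obtain c where c: "c \<in> C a" "c \<in> underS ?r d"
        unfolding acc_pts_def by blast
      then have "Z a \<in> underS ?r d"
        using wo_less_trans[OF wo _ c(2)] by (simp add: C_def)
      moreover have "d \<in> E a"
        using d acc_pts_mono[of "C a" "E a" ?r] \<open>acc_pts ?r (E a) \<subseteq> E a\<close> by (auto simp: C_def)
      ultimately show "d \<in> C a"
        by (simp add: C_def)
    qed
    ultimately show ?thesis
      using \<open>E a \<subseteq> Field ?r\<close> by (auto simp: club_def C_def)
  qed
  have "|C b - C a| <o ?r" if ab: "a \<in> underS t b" for a b
  proof -
    obtain z where z: "z \<in> Field ?r" "\<forall>y\<in>E b. z \<in> underS ?r y \<longrightarrow> y \<in> acc_pts ?r (E a)"
      using acc[OF ab] ..
    have "\<exists>y\<in>Field ?r. (z, y) \<in> ?r \<and> (Z a, y) \<in> ?r"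
      using wo_le_or_less[OF wo z(1) Z(1)[of a]] wo_refl[OF wo z(1)] wo_refl[OF wo Z(1)[of a]] z(1) Z(1)[of a]
      by (auto simp: underS_def)
    then obtain y where y: "y \<in> Field ?r" "(z, y) \<in> ?r" "(Z a, y) \<in> ?r"
      by blast
    have "y \<notin> underS ?r c" if c: "c \<in> C b - C a" for c
    proof
      assume "y \<in> underS ?r c"
      then have "z \<in> underS ?r c" "Z a \<in> underS ?r c"
        using wo_le_less_trans[OF wo y(2)] wo_le_less_trans[OF wo y(3)] by blast+
      then have "c \<in> acc_pts ?r (E a)"
        using z(2) c by (auto simp: C_def)
      then have "c \<in> E a"
        using E[OF less_Field1[OF ab]] by (auto simp: club_def)
      then show False
        using c \<open>Z a \<in> underS ?r c\<close> by (simp add: C_def)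
    qed
    then have "\<not> cofinal (C b - C a) ?r"
      using y(1) unfolding cofinal_underS by blast
    moreover have "C b - C a \<subseteq> Field ?r"
      using club[OF less_Field2[OF ab]] by (auto simp: club_def)
    ultimately show ?thesis
      using card_less_cofinal[OF s] by blast
  qed
  with club have "incr_seq t {C. club ?r C} (\<lambda>A B. |B - A| <o ?r) C"
    by (simp add: incr_seq_def)
  moreover have "acc_seq ?r t C"
    unfolding acc_seq_def
  proof (intro ballI impI subsetI)
    fix a b y assume ab: "a \<in> Field t" "b \<in> Field t" "underS t b = under t a" and y: "y \<in> C b"
    then have S: "(a, b) \<in> succ_rel t"
      by (simp add: succ_rel_def)
    have "Z a = Z b"
      unfolding Z_def succ_class_eq[OF S] ..
    then have yb: "y \<in> E b" "Z a \<in> underS ?r y"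
      using y by (auto simp: C_def)
    have "\<zeta> a \<in> underS ?r y"
      using wo_less_trans[OF wo Z(2)[OF succ_class_self ab(1)] yb(2)] .
    then have "y \<in> acc_pts ?r (E a)"
      using \<zeta> ab(1) S yb(1) by blast
    then show "y \<in> acc_pts ?r (C a)"
      unfolding C_def by (rule acc_pts_tail[OF wo _ yb(2)])
  qed
  ultimately show ?thesis
    by auto
qed

context depth_scale
begin

lemma has_seq_Clubs:
  assumes "\<And>i. i \<in> Field \<kappa> \<Longrightarrow> has_seq Clubs (L i) (\<theta> i)"
  shows "has_seq Clubs \<Lambda> t"
proof -
  have "\<forall>i. \<exists>C. i \<in> Field \<kappa> \<longrightarrow>
      incr_seq (\<theta> i) {C. club (L i) C} (\<lambda>A B. |B - A| <o L i) C \<and> acc_seq (L i) (\<theta> i) C"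
    using assms by simp
  from choice[OF this] obtain C where C: "\<forall>i. i \<in> Field \<kappa> \<longrightarrow>
      incr_seq (\<theta> i) {C. club (L i) C} (\<lambda>A B. |B - A| <o L i) (C i) \<and> acc_seq (L i) (\<theta> i) (C i)" ..
  have C_club: "club (L i) (C i (g a i))" if "i \<in> Field \<kappa>" "a \<in> Field t" for i a
    using C that g_Field by (simp add: incr_seq_def)
  define Y where "Y a = {\<Phi> u |u. u \<in> Prd \<and> (\<forall>\<^sub>F i in D. u i \<in> C i (g a i))}" for a
  have above: "\<exists>v\<in>Prd. (\<forall>\<^sub>F i in D. v i \<in> C i (g a i)) \<and> lt_on UNIV u v"
    if a: "a \<in> Field t" and u: "u \<in> Prd" for a u
  proof -
    have "\<forall>\<^sub>F i in D. \<exists>x\<in>Field (L i). x \<in> C i (g a i) \<and> u i \<in> underS (L i) x"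
      using ev_Field
    proof eventually_elim
      case (elim i)
      then have "u i \<in> Field (L i)"
        using u by (simp add: Prd_def)
      then show ?case
        using C_club[OF elim a] unfolding club_def cofinal_underS by blast
    qed
    then obtain v where "v \<in> Prd" "\<forall>\<^sub>F i in D. v i \<in> C i (g a i) \<and> u i \<in> underS (L i) (v i)"
      by (rule ae_choice)
    then show ?thesis
      by (auto simp: lt_on_def eventually_conj_iff)
  qed
  have Y_Field: "Y a \<subseteq> Field \<Lambda>" for a
    using \<Phi>_Field by (auto simp: Y_def)
  have Y_cofinal: "cofinal (Y a) \<Lambda>" if a: "a \<in> Field t" for a
    unfolding cofinal_underS
  proof
    fix z assume z: "z \<in> Field \<Lambda>"
    obtain v where v: "v \<in> Prd" "\<forall>\<^sub>F i in D. v i \<in> C i (g a i)" "lt_on UNIV (scale z) v"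
      using above[OF a scale(1)[OF z]] by blast
    have "z \<in> underS \<Lambda> (\<Phi> v)"
      using wo_le_less_trans[OF wo_\<Lambda> scale(2)[OF z] \<Phi>_strict[OF scale(1)[OF z] v(1,3)]] .
    then show "\<exists>y\<in>Y a. z \<in> underS \<Lambda> y"
      using v(1,2) by (auto simp: Y_def)
  qed
  \<comment> \<open>The relation between successive terms is proved first for the unclosed sets
    \<open>Y\<close>; taking closures at the end preserves it.\<close>
  have acc_Y: "\<exists>z\<in>Field \<Lambda>. \<forall>y\<in>Y b. z \<in> underS \<Lambda> y \<longrightarrow> y \<in> acc_pts \<Lambda> (Y a)" if ab: "a \<in> underS t b" for a b
  proof -
    have "\<forall>\<^sub>F i in D. \<exists>x\<in>Field (L i). \<forall>y\<in>C i (g b i). x \<in> underS (L i) y \<longrightarrow> y \<in> acc_pts (L i) (C i (g a i))"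
      using g_less[OF ab] ev_Field
    proof eventually_elim
      case (elim i)
      then show ?case
        using club_seq_almost_acc[OF inf_m[OF elim(2)] wo_\<theta>[OF elim(2)] _ _ elim(1)] C by blast
    qed
    then obtain x where x: "x \<in> Prd"
      "\<forall>\<^sub>F i in D. \<forall>y\<in>C i (g b i). x i \<in> underS (L i) y \<longrightarrow> y \<in> acc_pts (L i) (C i (g a i))"
      by (rule ae_choice)
    obtain z where z: "z \<in> Field \<Lambda>" "\<forall>u\<in>Prd. (z, \<Phi> u) \<in> \<Lambda> \<longrightarrow> lt_on UNIV x u"
      using \<Phi>_large[OF x(1)] ..
    have "\<Phi> u \<in> acc_pts \<Lambda> (Y a)"
      if u: "u \<in> Prd" "\<forall>\<^sub>F i in D. u i \<in> C i (g b i)" and zu: "z \<in> underS \<Lambda> (\<Phi> u)" for u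
    proof -
      have "lt_on UNIV x u"
        using z(2) u(1) underS_imp_le[OF zu] by blast
      then have acc: "\<forall>\<^sub>F i in D. u i \<in> acc_pts (L i) (C i (g a i))"
        unfolding lt_on_def using x(2) u(2) by eventually_elim blast
      \<comment> \<open>Some \<open>w\<close> below \<open>u\<close> has rank at least
        \<open>y\<close>. As \<open>u i\<close> is an accumulation point of
        \<open>C i (g a i)\<close>, a function \<open>v\<close> from these clubs fits strictly
        between \<open>w\<close> and \<open>u\<close>.\<close>
      have "\<exists>c\<in>Y a \<inter> underS \<Lambda> (\<Phi> u). y \<in> underS \<Lambda> c" if y: "y \<in> underS \<Lambda> (\<Phi> u)" for y
      proof -
        obtain w where w: "w \<in> Prd" "lt_on UNIV w u" "(y, \<Phi> w) \<in> \<Lambda>"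
          using \<Phi>_below[OF u(1) y] by blast
        have "\<forall>\<^sub>F i in D. \<exists>v\<in>Field (L i). v \<in> C i (g a i) \<and> w i \<in> underS (L i) v \<and> v \<in> underS (L i) (u i)"
          using acc w(2)[unfolded lt_on_def]
        proof eventually_elim
          case (elim i)
          then obtain c where "c \<in> C i (g a i)" "c \<in> underS (L i) (u i)" "w i \<in> underS (L i) c"
            unfolding acc_pts_def by blast
          then show ?case
            using less_Field1[of c "L i" "u i"] by blast
        qed
        then obtain v where v: "v \<in> Prd"
          "\<forall>\<^sub>F i in D. v i \<in> C i (g a i) \<and> w i \<in> underS (L i) (v i) \<and> v i \<in> underS (L i) (u i)"
          by (rule ae_choice)
        then have "lt_on UNIV w v" "lt_on UNIV v u" "\<Phi> v \<in> Y a"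
          by (auto simp: lt_on_def Y_def eventually_conj_iff)
        moreover have "y \<in> underS \<Lambda> (\<Phi> v)"
          using wo_le_less_trans[OF wo_\<Lambda> w(3) \<Phi>_strict[OF w(1) v(1)]] \<open>lt_on UNIV w v\<close> by blast
        ultimately show ?thesis
          using \<Phi>_strict[OF v(1) u(1)] by blast
      qed
      then show ?thesis
        using zu \<Phi>_Field[OF u(1)] unfolding acc_pts_def by blast
    qed
    then show ?thesis
      using z(1) unfolding Y_def by blast
  qed
  show ?thesis
  proof (rule trim_clubs[OF inf_\<mu> wo_t])
    let ?E = "\<lambda>a. Y a \<union> acc_pts \<Lambda> (Y a)"
    show "club \<Lambda> (?E a)" if "a \<in> Field t" for a
      using Y_Field[of a] cofinal_mono[OF Y_cofinal[OF that], of "?E a"] acc_pts_Un_acc_pts[OF wo_\<Lambda>, of "Y a"]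
      by (auto simp: club_def acc_pts_def[of \<Lambda> "Y a"])
    show "\<exists>z\<in>Field \<Lambda>. \<forall>y\<in>?E b. z \<in> underS \<Lambda> y \<longrightarrow> y \<in> acc_pts \<Lambda> (?E a)" if ab: "a \<in> underS t b" for a b
    proof -
      obtain z where z: "z \<in> Field \<Lambda>" "\<forall>y\<in>Y b. z \<in> underS \<Lambda> y \<longrightarrow> y \<in> acc_pts \<Lambda> (Y a)"
        using acc_Y[OF ab] ..
      have "y \<in> acc_pts \<Lambda> (Y a)" if y: "y \<in> ?E b" "z \<in> underS \<Lambda> y" for y
      proof (cases "y \<in> Y b")
        case False
        then have "y \<in> acc_pts \<Lambda> {c \<in> Y b. z \<in> underS \<Lambda> c}"
          using acc_pts_tail[OF wo_\<Lambda> _ y(2)] y(1) by blast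
        then have "y \<in> acc_pts \<Lambda> (Y a \<union> acc_pts \<Lambda> (Y a))"
          using acc_pts_mono[of "{c \<in> Y b. z \<in> underS \<Lambda> c}" "Y a \<union> acc_pts \<Lambda> (Y a)" \<Lambda>] z(2) by blast
        then show ?thesis
          by (simp add: acc_pts_Un_acc_pts[OF wo_\<Lambda>])
      qed (use z(2) y(2) in blast)
      then show ?thesis
        using z(1) by (auto simp: acc_pts_Un_acc_pts[OF wo_\<Lambda>])
    qed
  qed
qed

end


subsection \<open>Sequences of sets\<close>

context depth_scale
begin

text \<open>
  A subset of \<^term>\<open>\<Lambda>\<close> is coded by a set of partial functions with positive domain \<open>B\<close>, written as
  pairs \<open>(B, v)\<close> where \<open>v\<close> has a default value off \<open>B\<close>. Level \<open>z\<close> has those functions that are below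
  \<^term>\<open>scale z\<close> with constant \<^const>\<open>press\<close>, so that there are at most \<open>\<mu>\<close>, and that are above the
  earlier members of the scale.
\<close>

definition base :: "'k \<Rightarrow> 'a set" where
  "base = (SOME u. u \<in> Prd)"

definition level :: "'m set \<Rightarrow> ('k set \<times> ('k \<Rightarrow> 'a set)) set" where
  "level z = {(B, v). positive B \<and> v \<in> Prd \<and> (\<forall>i. i \<notin> B \<longrightarrow> v i = base i) \<and>
     (B, v) \<in> (\<Union>a\<in>Field \<kappa>. pieces (scale z) a) \<and> (\<forall>e\<in>underS \<Lambda> z. le_on B (scale e) v)}"

definition partials :: "('k set \<times> ('k \<Rightarrow> 'a set)) set" where
  "partials = (\<Union>z\<in>Field \<Lambda>. level z)"

definition partials_in :: "('k \<Rightarrow> 'a set set) \<Rightarrow> ('k set \<times> ('k \<Rightarrow> 'a set)) set" where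
  "partials_in S = {p \<in> partials. \<forall>\<^sub>F i in D. i \<in> fst p \<longrightarrow> snd p i \<in> S i}"

lemma base: "base \<in> Prd"
proof -
  have "\<forall>\<^sub>F i in D. \<exists>x\<in>Field (L i). True"
    using ev_Field
  proof eventually_elim
    case (elim i)
    then have "Field (L i) \<noteq> {}"
      using Cinfinite_cardSuc[OF inf_m[OF elim]] by (auto simp: cinfinite_def)
    then show ?case
      by blast
  qed
  then obtain u where "u \<in> Prd"
    by (rule ae_choice)
  then show ?thesis
    unfolding base_def by (rule someI[of "\<lambda>u. u \<in> Prd"])
qed

lemma card_level:
  assumes "z \<in> Field \<Lambda>"
  shows "|level z| \<le>o \<mu>"
proof (rule card_pieces[OF scale(1)[OF assms]])
  show "level z \<subseteq> (\<Union>a\<in>Field \<kappa>. pieces (scale z) a)"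
    by (auto simp: level_def)
  fix B v w assume *: "(B, v) \<in> level z" "(B, w) \<in> level z" "\<And>i. i \<in> B \<Longrightarrow> v i = w i"
  \<comment> \<open>The fixed default off \<open>B\<close> makes the whole function depend only on
    its restriction to \<open>B\<close>.\<close>
  have "v i = w i" for i
    using * by (cases "i \<in> B") (simp_all add: level_def)
  then show "v = w"
    by blast
qed

lemma inf_\<Lambda>: "Cinfinite \<Lambda>"
  using inf_\<mu> by (rule Cinfinite_cardSuc)

lemma \<Lambda>_no_max:
  assumes "z \<in> Field \<Lambda>"
  obtains y where "z \<in> underS \<Lambda> y"
  using infinite_Card_order_limit[of \<Lambda> z] inf_\<Lambda> assms by (auto simp: underS_def cinfinite_def)

lemma card_partials: "|partials| \<le>o \<Lambda>"
  unfolding partials_def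
proof (intro UNION_Cinfinite_bound ballI inf_\<Lambda>)
  show "|Field \<Lambda>| \<le>o \<Lambda>"
    using inf_\<Lambda> card_of_Field_ordIso ordIso_imp_ordLeq by blast
  fix z assume "z \<in> Field \<Lambda>"
  then show "|level z| \<le>o \<Lambda>"
    using ordLeq_transitive[OF card_level ordLess_imp_ordLeq[OF cardSuc_greater[OF card_\<mu>]]] by blast
qed

text \<open>From some level on, all partial functions are above a member of the scale that is above
  \<open>x\<close>. The exceptions lie in at most \<mu> levels, each of size at most \<mu>.\<close>

lemma card_partials_not_above:
  assumes "x \<in> Prd"
  shows "|{p \<in> partials. \<not> lt_on (fst p) x (snd p)}| \<le>o \<mu>" (is "|?X| \<le>o \<mu>")
proof -
  obtain z where z: "z \<in> Field \<Lambda>" "\<And>y. (z, y) \<in> \<Lambda> \<Longrightarrow> lt_on UNIV x (scale y)"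
    using scale_large[OF assms] by blast
  \<comment> \<open>Level \<open>z\<close> is above the scale only at points strictly before
    \<open>z\<close>, so the cut is made at some \<open>y\<close> beyond \<open>z\<close>.\<close>
  obtain y where y: "z \<in> underS \<Lambda> y"
    using \<Lambda>_no_max[OF z(1)] by blast
  have "?X \<subseteq> (\<Union>e\<in>underS \<Lambda> y. level e)"
  proof
    fix p assume p: "p \<in> ?X"
    then obtain e where e: "e \<in> Field \<Lambda>" "p \<in> level e"
      by (auto simp: partials_def)
    have "e \<in> underS \<Lambda> y"
    proof (rule ccontr)
      assume "e \<notin> underS \<Lambda> y"
      then have "(y, e) \<in> \<Lambda>"
        using wo_le_or_less[OF wo_\<Lambda> less_Field2[OF y] e(1)] by blast
      then have "z \<in> underS \<Lambda> e"
        using wo_less_le_trans[OF wo_\<Lambda> y] by blast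
      then have "le_on (fst p) (scale z) (snd p)"
        using e(2) by (auto simp: level_def)
      moreover have "lt_on (fst p) x (scale z)"
        using z(2)[OF wo_refl[OF wo_\<Lambda> z(1)]] unfolding lt_on_def by (rule eventually_mono) simp
      ultimately have "lt_on (fst p) x (snd p)"
        using lt_le_on_trans by blast
      then show False
        using p by blast
    qed
    then show "p \<in> (\<Union>e\<in>underS \<Lambda> y. level e)"
      using e(2) by blast
  qed
  moreover have "|\<Union>e\<in>underS \<Lambda> y. level e| \<le>o \<mu>"
  proof (intro UNION_Cinfinite_bound ballI inf_\<mu>)
    show "|underS \<Lambda> y| \<le>o \<mu>"
      using cardSuc_underS[OF card_\<mu> less_Field2[OF y]] .
    show "|level e| \<le>o \<mu>" if "e \<in> underS \<Lambda> y" for e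
      using card_level[OF less_Field1[OF that]] .
  qed
  ultimately show ?thesis
    using ordLeq_transitive[OF card_of_mono1] by blast
qed

text \<open>If there were at most \<mu> of them, some \<open>x\<close> would bound them all. A
  function \<open>v\<close> chosen from \<open>S\<close> high above \<open>x\<close> has a
  restriction lying in some level, and this is a partial function not bounded by
  \<open>x\<close>.\<close>

lemma card_partials_in:
  assumes S: "\<forall>\<^sub>F i in D. S i \<subseteq> Field (L i) \<and> cofinal (S i) (L i)"
  shows "\<not> |partials_in S| \<le>o \<mu>"
proof
  assume small: "|partials_in S| \<le>o \<mu>"
  have "snd ` partials_in S \<subseteq> Prd"
    by (auto simp: partials_in_def partials_def level_def)
  moreover have "|snd ` partials_in S| \<le>o \<mu>"
    using ordLeq_transitive[OF card_of_image small] .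
  ultimately obtain x where x: "x \<in> Prd" "\<And>w. w \<in> snd ` partials_in S \<Longrightarrow> lt_on UNIV w x"
    using common_bound by blast
  obtain z0 where z0: "z0 \<in> Field \<Lambda>" "\<And>y. (z0, y) \<in> \<Lambda> \<Longrightarrow> lt_on UNIV x (scale y)"
    using scale_large[OF x(1)] by blast
  \<comment> \<open>Taking \<open>z1\<close> strictly above \<open>z0\<close> puts
    \<open>scale z0\<close>, which is above \<open>x\<close>, among the functions that
    \<open>y\<close> bounds.\<close>
  obtain z1 where z1: "z0 \<in> underS \<Lambda> z1"
    using \<Lambda>_no_max[OF z0(1)] by blast
  have "scale ` underS \<Lambda> z1 \<subseteq> Prd"
    using scale(1) less_Field1 by fast
  moreover have "|scale ` underS \<Lambda> z1| \<le>o \<mu>"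
    using ordLeq_transitive[OF card_of_image cardSuc_underS[OF card_\<mu> less_Field2[OF z1]]] .
  ultimately obtain y where y: "y \<in> Prd" "\<And>w. w \<in> scale ` underS \<Lambda> z1 \<Longrightarrow> lt_on UNIV w y"
    using common_bound by blast
  have "\<forall>\<^sub>F i in D. \<exists>x\<in>Field (L i). x \<in> S i \<and> y i \<in> underS (L i) x"
    using S ev_Field
  proof eventually_elim
    case (elim i)
    moreover have "y i \<in> Field (L i)"
      using y(1) elim(2) by (simp add: Prd_def)
    ultimately show ?case
      unfolding cofinal_underS by blast
  qed
  then obtain v where v: "v \<in> Prd" "\<forall>\<^sub>F i in D. v i \<in> S i \<and> y i \<in> underS (L i) (v i)"
    by (rule ae_choice)
  then have vS: "\<forall>\<^sub>F i in D. v i \<in> S i" and yv: "lt_on UNIV y v"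
    by (simp_all add: lt_on_def eventually_conj_iff)
  have below: "le_on UNIV (scale e) v" if "e \<in> underS \<Lambda> z1" for e
    using lt_imp_le_on[OF lt_on_trans[OF y(2) yv]] that by blast
  obtain b where b: "b \<in> Field \<Lambda>" "\<And>y. (b, y) \<in> \<Lambda> \<Longrightarrow> lt_on UNIV v (scale y)"
    using scale_large[OF v(1)] by blast
  have not_both: "\<not> le_on UNIV u v" if "lt_on UNIV v u" for u
  proof
    assume "le_on UNIV u v"
    then have "\<forall>\<^sub>F i in D. False"
      using that[unfolded lt_on_def] ev_Field unfolding le_on_def
      by eventually_elim (use wo_less_not_le[OF wo_L] in auto)
    then show False
      using positive_UNIV by (simp add: frequently_def)
  qed
  have "\<not> le_on UNIV (scale b) v"
    using not_both b(2)[OF wo_refl[OF wo_\<Lambda> b(1)]] .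
  \<comment> \<open>The first place where the scale is not below \<open>v\<close> is the level of
    the required restriction: earlier members are below \<open>v\<close>, and \<open>v\<close> is
    below \<open>scale z\<close> on a positive set.\<close>
  then obtain z where z: "z \<in> Field \<Lambda>" "\<not> le_on UNIV (scale z) v"
    "\<And>e. e \<in> underS \<Lambda> z \<Longrightarrow> \<not> \<not> le_on UNIV (scale e) v"
    by (rule wo_least[OF wo_\<Lambda> b(1), of "\<lambda>z. \<not> le_on UNIV (scale z) v"]) (rule that)
  define B0 where "B0 = {i \<in> limits. v i \<in> underS (L i) (scale z i)}"
  have "positive B0"
  proof (rule ccontr)
    assume "\<not> positive B0"
    then have "\<forall>\<^sub>F i in D. i \<notin> B0"
      by (simp add: not_frequently)
    then have "le_on UNIV (scale z) v"
      unfolding le_on_def using ev_limits ev_Field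
    proof eventually_elim
      case (elim i)
      have "v i \<in> Field (L i)" "scale z i \<in> Field (L i)"
        using v(1) scale(1)[OF z(1)] elim(3) by (simp_all add: Prd_def)
      then show ?case
        using elim(1,2) wo_le_or_less[OF wo_L[OF elim(3)], of "scale z i" "v i"] by (auto simp: B0_def)
    qed
    then show False
      using z(2) by blast
  qed
  moreover have "\<forall>\<^sub>F i in D. i \<in> B0 \<longrightarrow> press (scale z) i (v i) \<in> underS \<kappa> i"
    using press(1)[OF scale(1)[OF z(1)]] by (simp add: B0_def)
  ultimately obtain a where a: "a \<in> Field \<kappa>" "positive {i \<in> B0. press (scale z) i (v i) = a}"
    using fodor[of B0 "\<lambda>i. press (scale z) i (v i)"] by blast
  define B where "B = {i \<in> B0. press (scale z) i (v i) = a}"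
  define w where "w i = (if i \<in> B then v i else base i)" for i
  have wP: "w \<in> Prd"
    using v(1) base by (simp add: w_def Prd_def)
  have le_w: "le_on B u w" if "le_on UNIV u v" for u
    using that unfolding le_on_def by (rule eventually_mono) (simp add: w_def)
  have "(B, w) \<in> pieces (scale z) a"
    using press(1)[OF scale(1)[OF z(1)]] by (auto simp: pieces_def B_def B0_def w_def)
  moreover have "\<forall>i. i \<notin> B \<longrightarrow> w i = base i"
    by (simp add: w_def)
  moreover have "\<forall>e\<in>underS \<Lambda> z. le_on B (scale e) w"
    using le_w z(3) by blast
  ultimately have "(B, w) \<in> level z"
    using a wP by (auto simp: level_def B_def[symmetric])
  moreover have "\<forall>\<^sub>F i in D. i \<in> B \<longrightarrow> w i \<in> S i"
    using vS by (rule eventually_mono) (simp add: w_def)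
  ultimately have "(B, w) \<in> partials_in S"
    using z(1) by (auto simp: partials_in_def partials_def)
  \<comment> \<open>The contradiction: on the positive set \<open>B\<close>, \<open>w\<close> is
    below \<open>x\<close>, which is below \<open>scale z0\<close>, which is at most
    \<open>w\<close>.\<close>
  then have wx: "lt_on UNIV w x"
    using x(2) by force
  have "lt_on UNIV x (scale z0)"
    using z0(2)[OF wo_refl[OF wo_\<Lambda> z0(1)]] .
  with wx have "lt_on UNIV w (scale z0)"
    by (rule lt_on_trans)
  then have "lt_on B w (scale z0)"
    unfolding lt_on_def by (rule eventually_mono) simp
  then have "lt_on B w w"
    using le_w[OF below[OF z1]] by (rule lt_le_on_trans)
  then have "\<forall>\<^sub>F i in D. i \<notin> B"
    unfolding lt_on_def by (rule eventually_mono) (simp add: underS_notIn)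
  then show False
    using a(2) by (simp add: B_def frequently_def)
qed

text \<open>Inside \<open>partials\<close>, unbounded is replaced by having more than \<mu>
  elements. Any injection \<open>h\<close> of \<open>partials\<close> into \<Lambda> then turns the
  sets \<open>Q a\<close> into the required subsets of \<Lambda>.\<close>

lemma has_seq_Sets:
  assumes "\<And>i. i \<in> Field \<kappa> \<Longrightarrow> has_seq Sets (L i) (\<theta> i)"
  shows "has_seq Sets \<Lambda> t"
proof -
  have "\<forall>i. \<exists>A. i \<in> Field \<kappa> \<longrightarrow> incr_seq (\<theta> i) {A. A \<subseteq> Field (L i) \<and> cofinal A (L i)} (less_sets (L i)) A"
    using assms by simp
  from choice[OF this] obtain A where A: "\<forall>i. i \<in> Field \<kappa> \<longrightarrow>
      incr_seq (\<theta> i) {A. A \<subseteq> Field (L i) \<and> cofinal A (L i)} (less_sets (L i)) (A i)" ..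
  define Q where "Q a = partials_in (\<lambda>i. A i (g a i))" for a
  have Q_sub: "Q a \<subseteq> partials" for a
    by (auto simp: Q_def partials_in_def)
  have A_cof: "A i (g a i) \<subseteq> Field (L i)" "cofinal (A i (g a i)) (L i)" if "i \<in> Field \<kappa>" "a \<in> Field t" for i a
    using A that g_Field by (simp_all add: incr_seq_def)
  have less: "\<forall>\<^sub>F i in D. less_sets (L i) (A i (g a i)) (A i (g b i))" if ab: "a \<in> underS t b" for a b
    using g_less[OF ab] ev_Field
  proof eventually_elim
    case (elim i)
    then show ?case
      using A g_Field[OF less_Field2[OF ab]] by (simp add: incr_seq_def)
  qed
  have big: "\<not> |Q a| \<le>o \<mu>" if "a \<in> Field t" for a
    unfolding Q_def by (rule card_partials_in, rule eventually_mono[OF ev_Field]) (simp add: A_cof[OF _ that])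
  have big_diff: "\<not> |Q b - Q a| \<le>o \<mu>" if ab: "a \<in> underS t b" for a b
  proof
    assume small: "|Q b - Q a| \<le>o \<mu>"
    let ?S = "\<lambda>i. A i (g b i) - A i (g a i)"
    \<comment> \<open>Domains are positive, so a partial function choosing from the differences
      cannot also choose from the sets of \<open>a\<close>.\<close>
    have "partials_in ?S \<subseteq> Q b - Q a"
    proof
      fix p assume p: "p \<in> partials_in ?S"
      then have S: "\<forall>\<^sub>F i in D. i \<in> fst p \<longrightarrow> snd p i \<in> ?S i" and pp: "p \<in> partials"
        by (auto simp: partials_in_def)
      have "p \<in> Q b"
        unfolding Q_def partials_in_def using pp S by (auto elim: eventually_mono)
      moreover have "p \<notin> Q a"
      proof
        assume "p \<in> Q a"
        then have "\<forall>\<^sub>F i in D. i \<in> fst p \<longrightarrow> snd p i \<in> A i (g a i)"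
          by (simp add: Q_def partials_in_def)
        with S have "\<forall>\<^sub>F i in D. i \<notin> fst p"
          by eventually_elim blast
        moreover have "positive (fst p)"
          using pp by (auto simp: partials_def level_def)
        ultimately show False
          by (simp add: frequently_def)
      qed
      ultimately show "p \<in> Q b - Q a"
        by blast
    qed
    then have "|partials_in ?S| \<le>o \<mu>"
      using ordLeq_transitive[OF card_of_mono1 small] by blast
    moreover have "\<forall>\<^sub>F i in D. ?S i \<subseteq> Field (L i) \<and> cofinal (?S i) (L i)"
      using less[OF ab] ev_Field
    proof eventually_elim
      case (elim i)
      then show ?case
        using A_cof(1)[OF elim(2) less_Field2[OF ab]] by (auto simp: less_sets_def)
    qed
    ultimately show False
      using card_partials_in[of ?S] by blast
  qed
  have small_diff: "|Q a - Q b| \<le>o \<mu>" if ab: "a \<in> underS t b" for a b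
  proof -
    have "\<forall>\<^sub>F i in D. \<exists>x\<in>Field (L i). \<forall>y\<in>A i (g a i). x \<in> underS (L i) y \<longrightarrow> y \<in> A i (g b i)"
      using less[OF ab] ev_Field
    proof eventually_elim
      case (elim i)
      then show ?case
        unfolding less_sets_def cofinal_underS by blast
    qed
    then obtain x where x: "x \<in> Prd"
      "\<forall>\<^sub>F i in D. \<forall>y\<in>A i (g a i). x i \<in> underS (L i) y \<longrightarrow> y \<in> A i (g b i)"
      by (rule ae_choice)
    \<comment> \<open>A partial function above \<open>x\<close> that chooses from the sets of
      \<open>a\<close> also chooses from those of \<open>b\<close>.\<close>
    have "Q a - Q b \<subseteq> {p \<in> partials. \<not> lt_on (fst p) x (snd p)}"
    proof
      fix p assume p: "p \<in> Q a - Q b"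
      have "\<not> lt_on (fst p) x (snd p)"
      proof
        assume lt: "lt_on (fst p) x (snd p)"
        have "\<forall>\<^sub>F i in D. i \<in> fst p \<longrightarrow> snd p i \<in> A i (g a i)"
          using p by (simp add: Q_def partials_in_def)
        then have "\<forall>\<^sub>F i in D. i \<in> fst p \<longrightarrow> snd p i \<in> A i (g b i)"
          using lt[unfolded lt_on_def] x(2) by eventually_elim blast
        then show False
          using p by (auto simp: Q_def partials_in_def)
      qed
      then show "p \<in> {p \<in> partials. \<not> lt_on (fst p) x (snd p)}"
        using p Q_sub by blast
    qed
    then show ?thesis
      using ordLeq_transitive[OF card_of_mono1 card_partials_not_above[OF x(1)]] by blast
  qed
  obtain h where h: "inj_on h partials" "h ` partials \<subseteq> Field \<Lambda>"
    using ordLeq_ordIso_trans[OF card_partials ordIso_symmetric[OF card_of_Field_ordIso]] inf_\<Lambda>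
    unfolding card_of_ordLeq[symmetric] by blast
  have h_cofinal: "cofinal (h ` X) \<Lambda> \<longleftrightarrow> \<not> |X| \<le>o \<mu>" if X: "X \<subseteq> partials" for X
  proof -
    have "|X| =o |h ` X|"
      using inj_on_subset[OF h(1) X] card_of_ordIso[of X "h ` X"] by (auto simp: bij_betw_def)
    then have "|X| \<le>o \<mu> \<longleftrightarrow> |h ` X| \<le>o \<mu>"
      using ordIso_ordLeq_trans[of "|X|" "|h ` X|" \<mu>] ordIso_ordLeq_trans[of "|h ` X|" "|X|" \<mu>]
        ordIso_symmetric[of "|X|" "|h ` X|"] by blast
    moreover have "h ` X \<subseteq> Field \<Lambda>"
      using h(2) X by blast
    ultimately show ?thesis
      using cofinal_cardSuc[OF inf_\<mu>, of "h ` X"] by simp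
  qed
  have h_diff: "h ` Q a - h ` Q b = h ` (Q a - Q b)" for a b
    using inj_on_image_set_diff[OF h(1)] Q_sub by (metis Diff_subset order_trans)
  have "incr_seq t {A. A \<subseteq> Field \<Lambda> \<and> cofinal A \<Lambda>} (less_sets \<Lambda>) (\<lambda>a. h ` Q a)"
    unfolding incr_seq_def less_sets_def h_diff
  proof (intro conjI ballI CollectI)
    fix a assume a: "a \<in> Field t"
    show "h ` Q a \<subseteq> Field \<Lambda>"
      using h(2) Q_sub by blast
    show "cofinal (h ` Q a) \<Lambda>"
      using h_cofinal[OF Q_sub] big[OF a] by blast
  next
    fix a b assume ab: "a \<in> underS t b"
    have "Q b - Q a \<subseteq> partials" "Q a - Q b \<subseteq> partials"
      using Q_sub by blast+
    then show "cofinal (h ` (Q b - Q a)) \<Lambda>" "\<not> cofinal (h ` (Q a - Q b)) \<Lambda>"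
      using h_cofinal big_diff[OF ab] small_diff[OF ab] by blast+
  qed
  then show ?thesis
    by auto
qed

end


subsection \<open>The depth cardinals\<close>

lemma ordLeq_embed:
  assumes "t' \<le>o t"
  obtains e where "\<And>a. a \<in> Field t' \<Longrightarrow> e a \<in> Field t"
    "\<And>a b. a \<in> underS t' b \<Longrightarrow> e a \<in> underS t (e b)"
    "\<And>a b. a \<in> Field t' \<Longrightarrow> b \<in> Field t' \<Longrightarrow> underS t' b = under t' a \<Longrightarrow> underS t (e b) = under t (e a)"
proof -
  \<comment> \<open>The embedding is onto an initial segment; this is what preserves immediate
    successors and hence \<open>acc_seq\<close>.\<close>
  obtain e where t: "Well_order t'" "Well_order t" and e: "embed t' t e"
    using assms by (auto simp: ordLeq_def)
  have under: "e ` under t' a = under t (e a)" if "a \<in> Field t'" for a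
    using e that by (simp add: embed_def bij_betw_def)
  have inj: "inj_on e (Field t')"
    using embed_inj_on[OF t(1) e] .
  have underS: "e ` underS t' a = underS t (e a)" if a: "a \<in> Field t'" for a
  proof -
    have "underS t' a = under t' a - {a}" "underS t (e a) = under t (e a) - {e a}"
      by (auto simp: underS_def under_def)
    moreover have "e ` (under t' a - {a}) = e ` under t' a - {e a}"
      using inj_on_image_set_diff[OF inj, of "under t' a" "{a}"] a under_Field[of t' a] by auto
    ultimately show ?thesis
      using under[OF a] by simp
  qed
  show thesis
  proof
    show "e a \<in> Field t" if "a \<in> Field t'" for a
      using embed_in_Field[OF e that] .
    show "e a \<in> underS t (e b)" if "a \<in> underS t' b" for a b
      using underS[OF less_Field2[OF that]] that by blast
    show "underS t (e b) = under t (e a)" if "a \<in> Field t'" "b \<in> Field t'" "underS t' b = under t' a" for a b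
      using underS[OF that(2)] under[OF that(1)] that(3) by simp
  qed
qed

lemma incr_seq_shorter:
  assumes "\<exists>f. incr_seq t P R f" and "t' \<le>o t"
  shows "\<exists>f. incr_seq t' P R f"
proof -
  obtain f where f: "incr_seq t P R f"
    using assms(1) ..
  obtain e where e: "\<And>a. a \<in> Field t' \<Longrightarrow> e a \<in> Field t" "\<And>a b. a \<in> underS t' b \<Longrightarrow> e a \<in> underS t (e b)"
    by (rule ordLeq_embed[OF assms(2)]) (rule that)
  have "incr_seq t' P R (\<lambda>a. f (e a))"
    using f e by (simp add: incr_seq_def)
  then show ?thesis
    by (rule exI[of _ "\<lambda>a. f (e a)"])
qed

lemma incr_acc_seq_shorter:
  assumes "\<exists>f. incr_seq t P R f \<and> acc_seq r t f" and "t' \<le>o t"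
  shows "\<exists>f. incr_seq t' P R f \<and> acc_seq r t' f"
proof -
  obtain f where f: "incr_seq t P R f" "acc_seq r t f"
    using assms(1) by blast
  obtain e where e: "\<And>a. a \<in> Field t' \<Longrightarrow> e a \<in> Field t" "\<And>a b. a \<in> underS t' b \<Longrightarrow> e a \<in> underS t (e b)"
    "\<And>a b. a \<in> Field t' \<Longrightarrow> b \<in> Field t' \<Longrightarrow> underS t' b = under t' a \<Longrightarrow> underS t (e b) = under t (e a)"
    by (rule ordLeq_embed[OF assms(2)]) (rule that)
  have "incr_seq t' P R (\<lambda>a. f (e a))"
    using f(1) e(1,2) by (simp add: incr_seq_def)
  moreover have "acc_seq r t' (\<lambda>a. f (e a))"
    using f(2) e(1,3) by (simp add: acc_seq_def)
  ultimately show ?thesis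
    by blast
qed

lemma has_seq_shorter: "has_seq l r t \<Longrightarrow> t' \<le>o t \<Longrightarrow> has_seq l r t'"
  by (cases l) (simp_all add: incr_seq_shorter incr_acc_seq_shorter)

section \<open>Least cardinals and the existence of sequences\<close>

lemma least_card:
  fixes P :: "'x rel \<Rightarrow> bool"
  assumes "Card_order d" and "P d"
  shows "Card_order (least_card P)" "P (least_card P)" "\<And>e. Card_order e \<Longrightarrow> P e \<Longrightarrow> least_card P \<le>o e"
proof -
  let ?Q = "\<lambda>d. Card_order d \<and> P d \<and> (\<forall>e. Card_order e \<and> P e \<longrightarrow> d \<le>o e)"
  have "\<exists>d\<in>{d. Card_order d \<and> P d}. \<forall>e\<in>{d. Card_order d \<and> P d}. d \<le>o e"
    by (rule exists_minim_Card_order) (use assms in auto)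
  then have "\<exists>d. ?Q d"
    by blast
  then have "?Q (least_card P)"
    unfolding least_card_def by (rule someI_ex)
  then show "Card_order (least_card P)" "P (least_card P)" "\<And>e. Card_order e \<Longrightarrow> P e \<Longrightarrow> least_card P \<le>o e"
    by blast+
qed

lemma less_least_card:
  fixes P :: "'x rel \<Rightarrow> bool" and t :: "'s rel"
  assumes "Card_order d" and "P d" and "Card_order t" and "t <o least_card P"
  shows "\<exists>e. t \<le>o e \<and> \<not> P e"
proof -
  \<comment> \<open>Minimality concerns cardinals on the type \<open>'x\<close>, so \<open>t\<close>
    is replaced by an isomorphic copy there.\<close>
  obtain e :: "'x rel" where e: "t =o e" "e <o least_card P"
    using assms(4) internalize_ordLess[of t "least_card P"] by blast
  have "Card_order e"
    using Card_order_ordIso2[OF assms(3) e(1)] .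
  then have "\<not> P e"
    using least_card(3)[of d P, OF assms(1,2)] e(2) not_ordLess_ordLeq by blast
  then show ?thesis
    using ordIso_imp_ordLeq[OF e(1)] by blast
qed

text \<open>This gives cardinals without sequences on the types used by \<^const>\<open>dp\<close> and \<^const>\<open>Depth_plus\<close>.\<close>

lemma not_inj_cardSuc_UNIV:
  fixes h :: "'p set \<Rightarrow> 'p"
  shows "\<not> inj_on h (Field (cardSuc |UNIV :: 'p set| ))"
proof
  let ?d = "cardSuc |UNIV :: 'p set|"
  assume "inj_on h (Field ?d)"
  then have "|Field ?d| \<le>o |UNIV :: 'p set|"
    by (intro card_of_ordLeqI) auto
  moreover have "|UNIV :: 'p set| <o ?d"
    using cardSuc_greater[OF card_of_Card_order] .
  moreover have "|Field ?d| =o ?d"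
    using card_of_Field_ordIso[OF cardSuc_Card_order[OF card_of_Card_order]] .
  ultimately show False
    using ordLeq_ordLess_trans not_ordLess_ordIso by blast
qed

lemma inj_on_wo:
  assumes "Well_order t" and "\<And>a b. a \<in> underS t b \<Longrightarrow> h a \<noteq> h b"
  shows "inj_on h (Field t)"
proof (rule inj_onI)
  fix a b assume "a \<in> Field t" "b \<in> Field t" "h a = h b"
  moreover from this have "b \<notin> underS t a" "a \<notin> underS t b"
    using assms(2)[of a b] assms(2)[of b a] by auto
  ultimately show "a = b"
    using wo_le_or_less[OF assms(1), of a b] by (auto simp: underS_def)
qed

text \<open>The least element of \<open>C\<close> above \<open>x\<close> is not an accumulation
  point, as no element of \<open>C\<close> lies strictly between.\<close>

lemma cofinal_not_acc:
  assumes r: "Well_order r" and C: "C \<subseteq> Field r" "cofinal C r" and x: "x \<in> Field r"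
  obtains y where "y \<in> C" "x \<in> underS r y" "y \<notin> acc_pts r C"
proof -
  obtain c where c: "c \<in> C \<and> x \<in> underS r c"
    using C(2) x unfolding cofinal_underS by blast
  then have "c \<in> Field r"
    using C(1) by blast
  then obtain y where y: "y \<in> C \<and> x \<in> underS r y" "\<And>c. c \<in> underS r y \<Longrightarrow> \<not> (c \<in> C \<and> x \<in> underS r c)"
    by (rule wo_least[OF r, of c "\<lambda>c. c \<in> C \<and> x \<in> underS r c", OF _ c]) (rule that)
  have "y \<notin> acc_pts r C"
  proof
    assume "y \<in> acc_pts r C"
    then obtain d where "d \<in> C" "d \<in> underS r y" "x \<in> underS r d"
      using y(1) unfolding acc_pts_def by blast
    then show False
      using y(2) by blast
  qed
  then show thesis
    using that y(1) by blast
qed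

text \<open>The printed condition allows only lengths 0 and 1: with a second term, all but boundedly
  many points of some club would be accumulation points of it.\<close>

lemma has_seq_Clubs_printed:
  assumes s: "Cinfinite s" and t: "Well_order t"
  shows "has_seq Clubs_printed (cardSuc s) t \<longleftrightarrow> (\<forall>b. underS t b = {})"
proof
  let ?r = "cardSuc s"
  have wo: "Well_order ?r"
    using s by (simp add: cardSuc_Well_order)
  have inf: "Cinfinite ?r"
    using s by (rule Cinfinite_cardSuc)
  show "\<forall>b. underS t b = {}" if seq: "has_seq Clubs_printed ?r t"
  proof (rule ccontr)
    assume "\<not> ?thesis"
    then obtain a b where ab: "a \<in> underS t b"
      by blast
    obtain C where C: "incr_seq t {C. club ?r C} (\<lambda>A B. |A - B| <o ?r) C" "acc_seq ?r t C"
      using seq by auto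
    obtain c where c: "c \<in> Field t" "underS t c = under t a" "a \<in> underS t c"
      using wo_successor[OF t ab] by blast
    have Ca: "C a \<subseteq> Field ?r" "cofinal (C a) ?r" and "|C a - C c| <o ?r"
      using C(1) c less_Field1[OF ab] by (auto simp: incr_seq_def club_def)
    then have "\<not> cofinal (C a - C c) ?r"
      using card_less_cofinal[OF s, of "C a - C c"] by auto
    then obtain x where x: "x \<in> Field ?r" "\<And>y. y \<in> C a - C c \<Longrightarrow> x \<notin> underS ?r y"
      unfolding cofinal_underS by blast
    obtain y where "y \<in> C a" "x \<in> underS ?r y" "y \<notin> acc_pts ?r (C a)"
      using cofinal_not_acc[OF wo Ca x(1)] by blast
    moreover have "C c \<subseteq> acc_pts ?r (C a)"
      using C(2) c less_Field1[OF ab] by (simp add: acc_seq_def)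
    ultimately show False
      using x(2) by blast
  qed
  show "has_seq Clubs_printed ?r t" if "\<forall>b. underS t b = {}"
  proof -
    have "cofinal (Field ?r) ?r"
      using infinite_Card_order_limit[of ?r] inf by (auto simp: cofinal_def cinfinite_def)
    then have "club ?r (Field ?r)"
      by (auto simp: club_def acc_pts_def)
    then have "incr_seq t {C. club ?r C} (\<lambda>A B. |A - B| <o ?r) (\<lambda>_. Field ?r)"
      using that by (simp add: incr_seq_def)
    moreover have "acc_seq ?r t (\<lambda>_. Field ?r)"
      using that wo_refl[OF t] by (auto simp: acc_seq_def under_def)
    ultimately show ?thesis
      by auto
  qed
qed

text \<open>The terms of a sequence of any kind can be coded by distinct elements of one type, which
  bounds the lengths of sequences and makes the least cardinal in \<open>dp\<close> exist.\<close>

lemma has_seq_inj: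
  fixes s :: "'b rel" and t :: "'x rel"
  assumes s: "Cinfinite s" and t: "Well_order t" and "has_seq l (cardSuc s) t"
  shows "\<exists>h :: 'x \<Rightarrow> 'b set set. inj_on h (Field t)"
proof -
  let ?r = "cardSuc s"
  have wo: "Well_order ?r"
    using s by (simp add: cardSuc_Well_order)
  have inf: "Cinfinite ?r"
    using s by (rule Cinfinite_cardSuc)
  then have infF: "infinite (Field ?r)"
    by (simp add: cinfinite_def)
  have cofF: "cofinal (Field ?r) ?r"
    using infinite_Card_order_limit[of ?r] inf by (auto simp: cofinal_def cinfinite_def)
  have ne: "\<not> cofinal {} ?r"
    using infF by (auto simp: cofinal_def)
  show ?thesis
  proof (cases l)
    case Clubs
    then obtain C where C: "incr_seq t {C. club ?r C} (\<lambda>A B. |B - A| <o ?r) C" "acc_seq ?r t C"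
      using assms(3) by auto
    have "C a \<noteq> C b" if ab: "a \<in> underS t b" for a b
    proof
      assume eq: "C a = C b"
      obtain x where x: "x \<in> Field ?r" "\<forall>y\<in>C b. x \<in> underS ?r y \<longrightarrow> y \<in> acc_pts ?r (C a)"
        using club_seq_almost_acc[OF s t C ab] ..
      have "C b \<subseteq> Field ?r" "cofinal (C b) ?r"
        using C(1) less_Field2[OF ab] by (auto simp: incr_seq_def club_def)
      then obtain y where "y \<in> C b" "x \<in> underS ?r y" "y \<notin> acc_pts ?r (C b)"
        using cofinal_not_acc[OF wo _ _ x(1)] by blast
      then show False
        using x(2) eq by simp
    qed
    then have "inj_on C (Field t)"
      by (rule inj_on_wo[OF t])
    then show ?thesis
      by blast
  next
    case Clubs_printed
    then have "underS t b = {}" for b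
      using assms(3) has_seq_Clubs_printed[OF s t] by simp
    then have "inj_on h (Field t)" for h :: "'x \<Rightarrow> 'b set set"
      by (intro inj_on_wo[OF t]) simp
    then show ?thesis
      by blast
  next
    case Functions
    then obtain f where f: "incr_seq t (Field ?r \<rightarrow> Field ?r) (less_bd ?r) f"
      using assms(3) by auto
    \<comment> \<open>A pairing function codes the graph of each function as a subset of
      \<open>Field ?r\<close>, which has the required type.\<close>
    have "|Field ?r \<times> Field ?r| \<le>o |Field ?r|"
      using card_of_Times_same_infinite[OF infF] by (rule ordIso_imp_ordLeq)
    then obtain p :: "'b set \<times> 'b set \<Rightarrow> 'b set" where p: "inj_on p (Field ?r \<times> Field ?r)"
      unfolding card_of_ordLeq[symmetric] by blast
    define h where "h a = p ` {(x, f a x) |x. x \<in> Field ?r}" for a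
    have "h a \<noteq> h b" if ab: "a \<in> underS t b" for a b
    proof
      assume "h a = h b"
      have fF: "f a \<in> Field ?r \<rightarrow> Field ?r" "f b \<in> Field ?r \<rightarrow> Field ?r" and lt: "less_bd ?r (f a) (f b)"
        using f less_Field1[OF ab] less_Field2[OF ab] ab by (auto simp: incr_seq_def)
      have "{(x, f a x) |x. x \<in> Field ?r} = {(x, f b x) |x. x \<in> Field ?r}"
        using \<open>h a = h b\<close> fF unfolding h_def by (subst (asm) inj_on_image_eq_iff[OF p]) auto
      then have "f a x = f b x" if "x \<in> Field ?r" for x
        using that by blast
      moreover have "(f b x, f b x) \<in> ?r" if "x \<in> Field ?r" for x
        by (rule wo_refl[OF wo]) (use fF(2) that in blast)
      ultimately have "{x \<in> Field ?r. (f b x, f a x) \<in> ?r} = Field ?r"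
        by auto
      then show False
        using lt cofF by (simp add: less_bd_def)
    qed
    then have "inj_on h (Field t)"
      by (rule inj_on_wo[OF t])
    then show ?thesis
      by blast
  next
    case Sets
    then obtain A where A: "incr_seq t {A. A \<subseteq> Field ?r \<and> cofinal A ?r} (less_sets ?r) A"
      using assms(3) by auto
    have "A a \<noteq> A b" if ab: "a \<in> underS t b" for a b
    proof
      assume "A a = A b"
      moreover have "cofinal (A b - A a) ?r"
        using A ab less_Field2[OF ab] by (simp add: incr_seq_def less_sets_def)
      ultimately show False
        using ne by simp
    qed
    then have "inj_on A (Field t)"
      by (rule inj_on_wo[OF t])
    then show ?thesis
      by blast
  qed
qed

lemma no_long_seq:
  assumes "Cinfinite (s :: 'b rel)"
  shows "\<not> has_seq l (cardSuc s) (cardSuc |UNIV :: 'b set set set| )"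
proof
  assume "has_seq l (cardSuc s) (cardSuc |UNIV :: 'b set set set| )"
  then obtain h :: "'b set set set \<Rightarrow> 'b set set" where "inj_on h (Field (cardSuc |UNIV :: 'b set set set| ))"
    using has_seq_inj[OF assms cardSuc_Well_order[OF card_of_Card_order]] by blast
  then show False
    using not_inj_cardSuc_UNIV by blast
qed

text \<open>Existence of a sequence passes to shorter lengths and fails for a long one, so the
  lengths that occur are exactly those below the least failure.\<close>

lemma less_dp_iff:
  assumes s: "Cinfinite s" and t: "Card_order t"
  shows "t <o dp l (cardSuc s) \<longleftrightarrow> has_seq l (cardSuc s) t"
proof
  note d = cardSuc_Card_order[OF card_of_Card_order] no_long_seq[OF s, of l]
  show "has_seq l (cardSuc s) t" if "t <o dp l (cardSuc s)"
    using less_least_card[of _ "\<lambda>t. \<not> has_seq l (cardSuc s) t", OF d t] that has_seq_shorter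
    unfolding dp_def by blast
  show "t <o dp l (cardSuc s)" if "has_seq l (cardSuc s) t"
  proof (rule ccontr)
    note lc = least_card[of _ "\<lambda>t. \<not> has_seq l (cardSuc s) t", OF d, folded dp_def]
    assume "\<not> ?thesis"
    then have "dp l (cardSuc s) \<le>o t"
      using not_ordLess_iff_ordLeq[OF Card_order_wo[OF lc(1)] Card_order_wo[OF t]] by blast
    then have "has_seq l (cardSuc s) (dp l (cardSuc s))"
      by (rule has_seq_shorter[OF that])
    then show False
      using lc(2) by blast
  qed
qed

text \<open>Irreflexivity makes the terms distinct, so no sequence has the length of the successor
  of the size of the type; the least cardinal therefore exists.\<close>

lemma less_Depth_plus:
  fixes P :: "'p set" and t :: "'s rel"
  assumes "Card_order t" and "t <o Depth_plus P R" and irrefl: "\<And>x. x \<in> P \<Longrightarrow> \<not> R x x"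
  shows "\<exists>f. incr_seq t P R f"
proof -
  let ?d = "cardSuc |UNIV :: 'p set|"
  have d: "Card_order ?d"
    by (rule cardSuc_Card_order[OF card_of_Card_order])
  have "\<not> (\<exists>f. incr_seq ?d P R f)"
  proof
    assume "\<exists>f. incr_seq ?d P R f"
    then obtain f where f: "incr_seq ?d P R f" ..
    have "f a \<noteq> f b" if ab: "a \<in> underS ?d b" for a b
    proof
      assume "f a = f b"
      then have "R (f b) (f b)" "f b \<in> P"
        using f ab less_Field2[OF ab] unfolding incr_seq_def by fastforce+
      then show False
        using irrefl by blast
    qed
    then have "inj_on f (Field ?d)"
      by (rule inj_on_wo[OF Card_order_wo[OF d]])
    then show False
      using not_inj_cardSuc_UNIV by blast
  qed
  from less_least_card[of _ "\<lambda>t. \<not> (\<exists>f. incr_seq t P R f)", OF d this assms(1)] assms(2)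
  show ?thesis
    unfolding Depth_plus_def using incr_seq_shorter by blast
qed

lemma (in depth_scale) has_seq:
  assumes "\<And>i. i \<in> Field \<kappa> \<Longrightarrow> has_seq l (L i) (\<theta> i)"
  shows "has_seq l \<Lambda> t"
proof (cases l)
  case Clubs_printed
  \<comment> \<open>Each \<open>\<theta> i\<close> has at most one element, so no two terms of
    \<open>g\<close> can be strictly ordered at any coordinate.\<close>
  have "a \<notin> underS t b" for a b
  proof
    assume "a \<in> underS t b"
    then have "\<forall>\<^sub>F i in D. g a i \<in> underS (\<theta> i) (g b i)"
      by (rule g_less)
    with ev_Field have "\<forall>\<^sub>F i in D. False"
    proof eventually_elim
      case (elim i)
      then show ?case
        using assms[OF elim(1)] has_seq_Clubs_printed[OF inf_m wo_\<theta>] Clubs_printed by simp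
    qed
    then show False
      using positive_UNIV by (simp add: frequently_def)
  qed
  then have "has_seq Clubs_printed \<Lambda> t"
    using has_seq_Clubs_printed[OF inf_\<mu> wo_t] by blast
  then show ?thesis
    by (simp only: Clubs_printed)
qed (use assms has_seq_Clubs has_seq_Functions has_seq_Sets in blast)+

theorem theorem5p4:
  fixes \<kappa> :: "'k rel"
    and m :: "'k \<Rightarrow> 'a rel"
    and \<mu> :: "'m rel"
    and D :: "'k filter"
    and \<theta> :: "'k \<Rightarrow> 't rel"
    and \<theta>' :: "'s rel"
    and l :: depth_kind
  assumes "Card_order \<kappa>" and "regularCard \<kappa>" and "natLeq <o \<kappa>"
    and "\<And>i. i \<in> Field \<kappa> \<Longrightarrow> Cinfinite (m i)"
    and "\<And>i j. j \<in> Field \<kappa> \<Longrightarrow> i \<in> underS \<kappa> j \<Longrightarrow> m i <o m j"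
    and "\<And>j. j \<in> acc_pts \<kappa> (Field \<kappa>) \<Longrightarrow> is_card_sup (m j) (underS \<kappa> j) m"
    and "is_card_sup \<mu> (Field \<kappa>) m"
    and "ctwo ^c \<kappa> <o \<mu>"
    and "\<And>i. i \<in> Field \<kappa> \<Longrightarrow> m i ^c \<kappa> <o \<mu>"
    and "normal_filter \<kappa> D"
    and "\<And>i. i \<in> Field \<kappa> \<Longrightarrow> Card_order (\<theta> i)"
    and "\<And>i. i \<in> Field \<kappa> \<Longrightarrow> \<theta> i <o dp l (cardSuc (m i))"
    and "Card_order \<theta>'"
    and "\<theta>' <o Depth_plus (\<Pi> i\<in>Field \<kappa>. Field (\<theta> i))
                (\<lambda>f g. \<forall>\<^sub>F i in D. f i \<in> underS (\<theta> i) (g i))"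
  shows "\<theta>' <o dp l (cardSuc \<mu>)"
proof -
  interpret card_scale \<kappa> m \<mu> D
    using assms(1-10) by unfold_locales blast+
  have "\<exists>g. incr_seq \<theta>' (\<Pi> i\<in>Field \<kappa>. Field (\<theta> i)) (\<lambda>f g. \<forall>\<^sub>F i in D. f i \<in> underS (\<theta> i) (g i)) g"
  proof (rule less_Depth_plus[OF assms(13,14)])
    \<comment> \<open>Irreflexivity modulo \<open>D\<close> holds because the filter is
      proper.\<close>
    show "\<not> (\<forall>\<^sub>F i in D. f i \<in> underS (\<theta> i) (f i))" for f
      using positive_UNIV by (simp add: underS_notIn frequently_def)
  qed
  then obtain g
    where g: "incr_seq \<theta>' (\<Pi> i\<in>Field \<kappa>. Field (\<theta> i)) (\<lambda>f g. \<forall>\<^sub>F i in D. f i \<in> underS (\<theta> i) (g i)) g" ..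
  interpret depth_scale \<kappa> m \<mu> D \<theta> \<theta>' g
    by unfold_locales (use assms(11,13) g Card_order_wo in blast)+
  have "has_seq l (cardSuc (m i)) (\<theta> i)" if "i \<in> Field \<kappa>" for i
    using assms(12)[OF that] less_dp_iff[OF inf_m[OF that] assms(11)[OF that]] by blast
  then have "has_seq l (cardSuc \<mu>) \<theta>'"
    by (rule has_seq)
  then show ?thesis
    using less_dp_iff[OF inf_\<mu> assms(13)] by blast
qed

end
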